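(* Let $\alpha\in(1,n]$ and let $m$ be an integer with $1\le m<n$. Assume $X\subseteq\delta\mathbb{Z}^n\cap[-1,1]^n$ is a Katz–Tao $(\delta,\alpha,C)$-set for some $C\lessapprox1$. Let $\varepsilon_0$ be any fixed small positive number, and let $\nu$ be the normalized Haar measure on $G(m,n)$. Then for all $V\in G(m,n)$ but a subset with $\nu$-measure at most $\varepsilon_0$, there is a set of $O(\delta^{-m})$ many essentially distinct $\delta$-neighborhoods of translated copies of $V^\perp$, denoted $\{{}^jV^\perp_\delta\}_{j=1}^{O(\delta^{-m})}$, perpendicular to $V$, such that the following holds. (1) $\bigcup_j{}^jV^\perp_\delta$ covers some $X'\subseteq X$ with $\#X'\gtrapprox\#X$. (2) For all ${}^jV^\perp_\delta$, $X'\cap{}^jV^\perp_\delta$ is a Katz–Tao $(\delta,\alpha-m,C)$-set.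
   Context: $0<\delta<1$ is a small parameter. $G(m,n)$ is the Grassmannian of $m$-dimensional linear subspaces of $\mathbb{R}^n$, and $V^\perp$ is the orthogonal complement of $V$. A set $Y$ is a Katz–Tao $(\delta,\alpha,C)$-set if $|Y\cap B(x,r)|_\delta\le C(r/\delta)^\alpha$ for all $x\in\mathbb{R}^n$, $r\in[\delta,1]$, where $|\cdot|_\delta$ is the cardinality of a maximal $\delta$-separated subset. $\#$ is cardinality. $A_1\lessapprox A_2$ means $A_1\le C_\varepsilon\delta^{-\varepsilon}A_2$ for every $\varepsilon>0$, with $C_\varepsilon$ independent of $\delta$; $A_1\gtrapprox A_2$ means $A_2\lessapprox A_1$. "Essentially distinct" is used in the usual informal sense: the neighborhoods correspond to base points in $V$ that are separated by a distance comparable to $\delta$.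
   Formalization: In (2) the exponent α−m is replaced by max(α−m, 0), which differs only when α < m; there the claim as written fails, e.g. for X = {0} and C = 1, where a Katz–Tao set with negative exponent must be empty. *)

theory Defs
  imports "HOL-Analysis.Analysis"
begin

definition separated :: "real \<Rightarrow> 'a::metric_space set \<Rightarrow> bool" where
  "separated \<delta> S \<longleftrightarrow> (\<forall>x\<in>S. \<forall>y\<in>S. x \<noteq> y \<longrightarrow> \<delta> \<le> dist x y)"

text \<open>
  The cardinality of a \<open>\<delta>\<close>-separated subset of \<open>A\<close> that is maximal, read as: of maximum
  cardinality. It is only meaningful for bounded \<open>A\<close>, where the supremum is over a finite set.
\<close>

definition sep_card :: "real \<Rightarrow> 'a::metric_space set \<Rightarrow> nat" where
  "sep_card \<delta> A = Sup {card S | S. S \<subseteq> A \<and> finite S \<and> separated \<delta> S}"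

text \<open>
  Only exponents \<open>\<alpha> \<ge> 0\<close> are meaningful: for \<open>\<alpha> < 0\<close> the case \<open>r = 1\<close> bounds the number of
  points in a unit ball by \<open>C * \<delta> powr (-\<alpha>)\<close>, so \<open>Y\<close> is empty as soon as this is less than 1.
\<close>

definition katz_tao :: "real \<Rightarrow> real \<Rightarrow> real \<Rightarrow> 'a::metric_space set \<Rightarrow> bool" where
  "katz_tao \<delta> \<alpha> C Y \<longleftrightarrow>
     (\<forall>x. \<forall>r\<in>{\<delta>..1}. real (sep_card \<delta> (Y \<inter> cball x r)) \<le> C * (r / \<delta>) powr \<alpha>)"

text \<open>
  \<open>A\<^sub>1\<close> is at most \<open>A\<^sub>2\<close> up to \<open>\<delta>\<close>-losses. The constants \<open>C\<^sub>\<epsilon>\<close> form an explicit argument \<open>K\<close>;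
  their independence of \<open>\<delta>\<close> is expressed by quantifying \<open>K\<close> outside \<open>\<delta>\<close>.
\<close>

definition lessapprox :: "(real \<Rightarrow> real) \<Rightarrow> real \<Rightarrow> real \<Rightarrow> real \<Rightarrow> bool" where
  "lessapprox K \<delta> A\<^sub>1 A\<^sub>2 \<longleftrightarrow> (\<forall>\<epsilon>>0. A\<^sub>1 \<le> K \<epsilon> * \<delta> powr (-\<epsilon>) * A\<^sub>2)"

definition grid_cube :: "real \<Rightarrow> (real ^ 'n) set" where
  "grid_cube \<delta> = {x. (\<forall>i. \<exists>k::int. x $ i = \<delta> * of_int k) \<and> (\<forall>i. x $ i \<in> {-1..1})}"

definition grassmannian :: "nat \<Rightarrow> (real ^ 'n) set set" where
  "grassmannian m = {V. subspace V \<and> dim V = m}"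

text \<open>
  The topology of the Grassmannian is the one induced by the embedding that sends \<open>V\<close> to the matrix
  of the orthogonal projection onto \<open>V\<close>, which is the map \<open>closest_point V\<close>; the Borel sets are
  therefore the preimages of Borel sets of matrices.
\<close>

definition grassmannian_borel :: "nat \<Rightarrow> (real ^ 'n) set measure" where
  "grassmannian_borel m =
     vimage_algebra (grassmannian m) (\<lambda>V. matrix (closest_point V)) (borel :: (real ^ 'n ^ 'n) measure)"

text \<open>
  The normalized Haar measure, given by its defining property: the (unique) Borel probability
  measure on the Grassmannian that is invariant under the action of the orthogonal group.
\<close>

definition grassmannian_haar :: "nat \<Rightarrow> (real ^ 'n) set measure \<Rightarrow> bool" where
  "grassmannian_haar m \<nu> \<longleftrightarrow>
     space \<nu> = grassmannian m \<and>
     sets \<nu> = sets (grassmannian_borel m) \<and>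
     emeasure \<nu> (space \<nu>) = 1 \<and>
     (\<forall>T A. orthogonal_transformation T \<longrightarrow> A \<in> sets \<nu> \<longrightarrow>
        emeasure \<nu> ((\<lambda>V. T ` V) ` A) = emeasure \<nu> A)"

definition neighborhood :: "real \<Rightarrow> 'a::metric_space set \<Rightarrow> 'a set" where
  "neighborhood \<delta> S = {x. infdist x S < \<delta>}"

definition fibre_nbhd :: "real \<Rightarrow> (real ^ 'n) set \<Rightarrow> real ^ 'n \<Rightarrow> (real ^ 'n) set" where
  "fibre_nbhd \<delta> V p = neighborhood \<delta> ((+) p ` (V\<^sup>\<bottom>))"

end

(*
  Two points x, y have the same fibre over V, up to 4 delta, only if the projection of x - y to V
  has length at most 4 delta. By rotation invariance the measure of these V depends only on |x - y|,
  and averaging over a grid of directions bounds it by a constant times (delta / |x - y|)^m. Summing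
  (delta / |x - y|)^(max (alpha - m) 0) over such pairs and integrating in V therefore costs at most
  the sum of (delta / |x - y|)^alpha, which the Katz-Tao condition bounds by C log(1/delta) for each x.
  Markov's inequality in V, and then in x, gives for most V at least half of X on which all slices
  are Katz-Tao with constant C log(1/delta). A maximal subset with the constant C itself still
  contains a proportion 1/log(1/delta) of these points, by a Vitali covering argument.
*)

theory Submission
  imports Defs
begin

subsection \<open>Orthogonal projections\<close>

text \<open>The slices must inherit the constant C itself. Averaging alone gives C times a
  logarithm, so it is followed by an extremal choice that moves the logarithm from the constant to
  the cardinality. The logarithm is the number of dyadic scales: after integration over V each scale
  contributes the same amount. Fibre neighborhoods overlap, so they cannot be treated one at a time.
  The extremal set satisfies the bound in all of them at once, and losses are counted on disjoint
  truncated fibres only. The tolerance 4 \<delta> comes from there: projections of two points in one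
  fibre neighborhood are within 2 \<delta>, and passing through a common point of two neighborhoods
  doubles this. With q = \<delta> / max |x - y| \<delta>, the weight q^\<beta> times a probability
  of order q^m is of order at most q^\<alpha>, since q \<le> 1 and \<beta> + m \<ge> \<alpha>. Thus
  the estimate also covers \<alpha> < m, with \<beta> = 0.\<close>

lemma closest_point_subspace_mem:
  fixes V :: "'a::euclidean_space set"
  assumes "subspace V"
  shows "closest_point V x \<in> V"
  using assms closed_subspace[OF assms] subspace_0[OF assms] by (metis closest_point_in_set empty_iff)

text \<open>By Pythagoras, an orthogonal residual identifies the nearest point. Linearity and
  equivariance of the projection are then checks of orthogonality.\<close>

lemma closest_point_subspace_eqI:
  fixes V :: "'a::euclidean_space set"
  assumes V: "subspace V" and y: "y \<in> V" and orth: "\<And>z. z \<in> V \<Longrightarrow> (x - y) \<bullet> z = 0"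
  shows "closest_point V x = y"
proof -
  have "dist x y \<le> dist x z" if "z \<in> V" for z
  proof -
    have "y - z \<in> V" using V y that by (simp add: subspace_diff)
    then have "orthogonal (x - y) (y - z)" by (simp add: orth orthogonal_def)
    from norm_add_Pythagorean[OF this] have "(norm (x - z))\<^sup>2 = (norm (x - y))\<^sup>2 + (norm (y - z))\<^sup>2"
      by simp
    then have "(norm (x - y))\<^sup>2 \<le> (norm (x - z))\<^sup>2" by simp
    then show ?thesis by (simp add: dist_norm)
  qed
  then show ?thesis
    using closest_point_unique[OF subspace_imp_convex[OF V] closed_subspace[OF V] y] by metis
qed

lemma closest_point_subspace_orthogonal:
  fixes V :: "'a::euclidean_space set"
  assumes V: "subspace V" and z: "z \<in> V"
  shows "(x - closest_point V x) \<bullet> z = 0"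
proof -
  obtain a b where a: "a \<in> span V" and b: "\<And>w. w \<in> span V \<Longrightarrow> orthogonal b w" and x: "x = a + b"
    using orthogonal_subspace_decomp_exists[of V x] by metis
  have sp: "span V = V" using V by (simp add: span_eq_iff)
  have "closest_point V x = a"
    using a b sp x by (intro closest_point_subspace_eqI V) (auto simp: orthogonal_def)
  then show ?thesis using x b z sp by (auto simp: orthogonal_def)
qed

lemma linear_closest_point_subspace:
  fixes V :: "'a::euclidean_space set"
  assumes V: "subspace V"
  shows "linear (closest_point V)"
proof (rule linearI)
  note [simp] = closest_point_subspace_mem[OF V] subspace_add[OF V] subspace_scale[OF V]
  fix x y :: 'a and c :: real
  have 1: "(x + y - (closest_point V x + closest_point V y)) \<bullet> z = 0" if "z \<in> V" for z
    using closest_point_subspace_orthogonal[OF V that, of x]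
      closest_point_subspace_orthogonal[OF V that, of y] by (simp add: inner_diff_left inner_add_left)
  show "closest_point V (x + y) = closest_point V x + closest_point V y"
    by (rule closest_point_subspace_eqI[OF V _ 1]) auto
  have 2: "(c *\<^sub>R x - c *\<^sub>R closest_point V x) \<bullet> z = 0" if "z \<in> V" for z
    using closest_point_subspace_orthogonal[OF V that, of x] by (simp add: inner_diff_left)
  show "closest_point V (c *\<^sub>R x) = c *\<^sub>R closest_point V x"
    by (rule closest_point_subspace_eqI[OF V _ 2]) auto
qed

lemma norm_closest_point_subspace_le:
  fixes V :: "'a::euclidean_space set"
  assumes V: "subspace V"
  shows "norm (closest_point V x) \<le> norm x"
proof -
  have "orthogonal (x - closest_point V x) (closest_point V x)"
    by (simp add: orthogonal_def closest_point_subspace_orthogonal closest_point_subspace_mem V)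
  from norm_add_Pythagorean[OF this]
  have "(norm (closest_point V x))\<^sup>2 \<le> (norm x)\<^sup>2" by simp
  then show ?thesis by simp
qed

lemma closest_point_orthogonal_transformation:
  fixes V :: "'a::euclidean_space set" and T :: "'a \<Rightarrow> 'a"
  assumes V: "subspace V" and T: "orthogonal_transformation T"
  shows "closest_point (T ` V) (T x) = T (closest_point V x)"
proof (rule closest_point_subspace_eqI)
  have lin: "linear T" using T by (rule orthogonal_transformation_linear)
  show "subspace (T ` V)" by (rule linear_subspace_image[OF lin V])
  show "T (closest_point V x) \<in> T ` V" using closest_point_subspace_mem[OF V] by blast
  fix z assume "z \<in> T ` V"
  then obtain y where y: "y \<in> V" "z = T y" by auto
  have "(T x - T (closest_point V x)) \<bullet> z = T (x - closest_point V x) \<bullet> T y"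
    by (simp add: y linear_diff[OF lin])
  also have "\<dots> = 0"
    using T closest_point_subspace_orthogonal[OF V y(1), of x] by (simp add: orthogonal_transformation_def)
  finally show "(T x - T (closest_point V x)) \<bullet> z = 0" .
qed

text \<open>The point of the fibre nearest to x is p plus the residual of x, and projection does not
  increase distances. Tubes thereby become preimages of balls in V, the only form in which they are
  counted.\<close>

lemma mem_fibre_nbhd_iff:
  fixes V :: "(real ^ 'n) set"
  assumes V: "subspace V" and p: "p \<in> V"
  shows "x \<in> fibre_nbhd \<delta> V p \<longleftrightarrow> norm (closest_point V x - p) < \<delta>"
proof -
  have "infdist x ((+) p ` (V\<^sup>\<bottom>)) = norm (closest_point V x - p)"
  proof (rule antisym)
    have "x - closest_point V x \<in> V\<^sup>\<bottom>"
      using closest_point_subspace_orthogonal[OF V, of _ x]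
      by (auto simp: orthogonal_comp_def orthogonal_def inner_commute)
    then have "p + (x - closest_point V x) \<in> (+) p ` (V\<^sup>\<bottom>)" by (rule imageI)
    then have "infdist x ((+) p ` (V\<^sup>\<bottom>)) \<le> dist x (p + (x - closest_point V x))" by (rule infdist_le)
    then show "infdist x ((+) p ` (V\<^sup>\<bottom>)) \<le> norm (closest_point V x - p)"
      by (simp add: dist_norm)
    have ne: "(+) p ` (V\<^sup>\<bottom>) \<noteq> {}" using subspace_0[OF subspace_orthogonal_comp] by blast
    have "norm (closest_point V x - p) \<le> dist x a" if mem: "a \<in> (+) p ` (V\<^sup>\<bottom>)" for a
    proof -
      obtain w where w: "w \<in> V\<^sup>\<bottom>" "a = p + w" using mem by blast
      have "closest_point V (x - a) = closest_point V x - p"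
      proof (rule closest_point_subspace_eqI[OF V])
        show "closest_point V x - p \<in> V" by (simp add: V p closest_point_subspace_mem subspace_diff)
        fix z assume z: "z \<in> V"
        have "w \<bullet> z = 0" using w z by (auto simp: orthogonal_comp_def orthogonal_def inner_commute)
        then show "(x - a - (closest_point V x - p)) \<bullet> z = 0"
          using closest_point_subspace_orthogonal[OF V z, of x] w
          by (simp add: inner_diff_left inner_add_left)
      qed
      then show ?thesis using norm_closest_point_subspace_le[OF V, of "x - a"] by (simp add: dist_norm)
    qed
    then show "norm (closest_point V x - p) \<le> infdist x ((+) p ` (V\<^sup>\<bottom>))"
      unfolding infdist_notempty[OF ne] using ne by (intro cINF_greatest) auto
  qed
  then show ?thesis by (simp add: fibre_nbhd_def neighborhood_def)
qed

subsection \<open>Separated sets\<close>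

text \<open>Coordinates in orthonormal bases of V and its complement, rounded to a mesh finer than
  the separation, determine the point; so the boxes are counted instead. The two radii are
  independent because the lemma serves both a thin slab around the complement and points lying in
  V.\<close>

lemma card_separated_le:
  fixes V P :: "'a::euclidean_space set" and a R :: real
  assumes V: "subspace V" and t: "0 < t" and sep: "separated t P"
    and a: "\<And>p. p \<in> P \<Longrightarrow> norm (closest_point V p) \<le> a"
    and R: "\<And>p. p \<in> P \<Longrightarrow> norm (p - closest_point V p) \<le> R"
    and nonneg: "0 \<le> a" "0 \<le> R"
  shows "real (card P) \<le> (4 * DIM('a) * a / t + 2) ^ dim V * (4 * DIM('a) * R / t + 2) ^ (DIM('a) - dim V)"
proof -
  define W where "W = V\<^sup>\<bottom>"
  have W: "subspace W" unfolding W_def by (rule subspace_orthogonal_comp)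
  have dW: "dim W = DIM('a) - dim V"
  proof -
    have "W = {y \<in> UNIV. \<forall>x\<in>V. orthogonal x y}" by (auto simp: W_def orthogonal_comp_def)
    then show ?thesis
      using dim_subspace_orthogonal_to_vectors[OF V subspace_UNIV subset_UNIV] by simp
  qed
  obtain B where B: "B \<subseteq> V" "pairwise orthogonal B" "\<And>x. x \<in> B \<Longrightarrow> norm x = 1"
    "independent B" "card B = dim V" "span B = V"
    using orthonormal_basis_subspace[OF V] by metis
  obtain D where D: "D \<subseteq> W" "pairwise orthogonal D" "\<And>x. x \<in> D \<Longrightarrow> norm x = 1"
    "independent D" "card D = dim W" "span D = W"
    using orthonormal_basis_subspace[OF W] by metis
  have fin: "finite B" "finite D" using B D by (auto simp: independent_imp_finite)
  have disj: "B \<inter> D = {}"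
  proof -
    have "x \<bullet> x = 0" if "x \<in> B" "x \<in> D" for x
      using that B(1) D(1) unfolding W_def orthogonal_comp_def orthogonal_def by blast
    then show ?thesis using B(3) by fastforce
  qed
  define N where "N = DIM('a)"
  have cBD: "card (B \<union> D) = N"
    using fin disj dW B(5) D(5) dim_subset_UNIV[of V] by (simp add: card_Un_disjoint N_def)
  have N: "0 < N" by (simp add: N_def)
  \<comment> \<open>Points with equal rounded coordinates differ by at most N h = t / 2 in the l1
    norm, which is less than the separation.\<close>
  define h where "h = t / (2 * real N)"
  have h: "0 < h" using t N by (simp add: h_def)
  \<comment> \<open>\<open>restrict\<close> makes the rounded coordinates extensional, so that they
    lie in a finite \<open>PiE\<close>.\<close>
  define g where "g p = restrict (\<lambda>b. \<lfloor>p \<bullet> b / h\<rfloor>) (B \<union> D)" for p :: 'a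
  define Y where "Y b = (if b \<in> B then a / h else R / h)" for b
  have ip: "\<bar>p \<bullet> b\<bar> \<le> norm (closest_point V p)" if "b \<in> B" for p b
  proof -
    have "p \<bullet> b = closest_point V p \<bullet> b"
      using closest_point_subspace_orthogonal[OF V, of b p] that B(1) by (auto simp: inner_diff_left)
    then show ?thesis using Cauchy_Schwarz_ineq2[of "closest_point V p" b] B(3)[OF that] by simp
  qed
  have ip': "\<bar>p \<bullet> b\<bar> \<le> norm (p - closest_point V p)" if "b \<in> D" for p b
  proof -
    have "closest_point V p \<bullet> b = 0"
      using closest_point_subspace_mem[OF V, of p] that D(1)
      by (auto simp: W_def orthogonal_comp_def orthogonal_def)
    then have "p \<bullet> b = (p - closest_point V p) \<bullet> b" by (simp add: inner_diff_left)
    then show ?thesis using Cauchy_Schwarz_ineq2[of "p - closest_point V p" b] D(3)[OF that] by simp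
  qed
  have expand: "norm x \<le> (\<Sum>b\<in>B \<union> D. \<bar>x \<bullet> b\<bar>)" for x
  proof -
    let ?v = "closest_point V x"
    have sum1: "norm y \<le> (\<Sum>b\<in>S. \<bar>y \<bullet> b\<bar>)" if "pairwise orthogonal S" "\<And>b. b \<in> S \<Longrightarrow> norm b = 1"
      "finite S" "y \<in> span S" for y :: 'a and S
    proof -
      have "y = (\<Sum>b\<in>S. (y \<bullet> b) *\<^sub>R b)" using orthonormal_basis_expand[OF that(1,2,4,3)] by simp
      then have "norm y = norm (\<Sum>b\<in>S. (y \<bullet> b) *\<^sub>R b)" by simp
      also have "\<dots> \<le> (\<Sum>b\<in>S. norm ((y \<bullet> b) *\<^sub>R b))" by (rule norm_sum)
      also have "\<dots> = (\<Sum>b\<in>S. \<bar>y \<bullet> b\<bar>)" by (intro sum.cong refl) (simp add: that inner_commute)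
      finally show ?thesis .
    qed
    have xv: "x - ?v \<in> W"
      using closest_point_subspace_orthogonal[OF V, of _ x]
      by (auto simp: W_def orthogonal_comp_def orthogonal_def inner_commute)
    have "norm x \<le> norm ?v + norm (x - ?v)" by (metis add.commute diff_add_cancel norm_triangle_ineq)
    also have "norm ?v \<le> (\<Sum>b\<in>B. \<bar>?v \<bullet> b\<bar>)"
      using closest_point_subspace_mem[OF V, of x] B(6) by (intro sum1[OF B(2,3) fin(1)]) auto
    also have "(\<Sum>b\<in>B. \<bar>?v \<bullet> b\<bar>) = (\<Sum>b\<in>B. \<bar>x \<bullet> b\<bar>)"
      using closest_point_subspace_orthogonal[OF V, of _ x] B(1)
      by (intro sum.cong refl) (auto simp: inner_diff_left)
    also have "norm (x - ?v) \<le> (\<Sum>b\<in>D. \<bar>(x - ?v) \<bullet> b\<bar>)"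
      using xv D(6) by (intro sum1[OF D(2,3) fin(2)]) auto
    also have "(\<Sum>b\<in>D. \<bar>(x - ?v) \<bullet> b\<bar>) = (\<Sum>b\<in>D. \<bar>x \<bullet> b\<bar>)"
      using closest_point_subspace_mem[OF V, of x] D(1)
      by (intro sum.cong refl) (auto simp: inner_diff_left W_def orthogonal_comp_def orthogonal_def)
    finally show ?thesis using fin disj by (simp add: sum.union_disjoint)
  qed
  have inj: "inj_on g P"
  proof (rule inj_onI, rule ccontr)
    fix p q assume pq: "p \<in> P" "q \<in> P" "g p = g q" "p \<noteq> q"
    have "\<bar>(p - q) \<bullet> b\<bar> \<le> h" if "b \<in> B \<union> D" for b
    proof -
      have "\<lfloor>p \<bullet> b / h\<rfloor> = \<lfloor>q \<bullet> b / h\<rfloor>"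
        using fun_cong[OF pq(3), of b] that by (simp add: g_def)
      then have "\<bar>p \<bullet> b / h - q \<bullet> b / h\<bar> \<le> 1" by linarith
      then have "\<bar>(p - q) \<bullet> b\<bar> / h \<le> 1"
        using h by (simp add: inner_diff_left diff_divide_distrib[symmetric])
      then show ?thesis using h by simp
    qed
    then have "(\<Sum>b\<in>B \<union> D. \<bar>(p - q) \<bullet> b\<bar>) \<le> (\<Sum>b\<in>B \<union> D. h)" by (rule sum_mono)
    then have "norm (p - q) \<le> real N * h" using expand[of "p - q"] cBD by simp
    also have "\<dots> < t" using t N by (simp add: h_def)
    finally show False using sep pq unfolding separated_def dist_norm by fastforce
  qed
  have img: "g ` P \<subseteq> PiE (B \<union> D) (\<lambda>b. {\<lfloor>- Y b\<rfloor>..\<lfloor>Y b\<rfloor>})"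
  proof (intro image_subsetI PiE_I)
    fix p b assume p: "p \<in> P" and b: "b \<in> B \<union> D"
    have "\<bar>p \<bullet> b\<bar> \<le> (if b \<in> B then a else R)"
      using b ip[of b p] ip'[of b p] a[OF p] R[OF p] by auto
    then have "\<bar>p \<bullet> b\<bar> / h \<le> Y b" using h by (auto simp: Y_def divide_right_mono)
    then have "\<bar>p \<bullet> b / h\<bar> \<le> Y b" using h by simp
    then have "- Y b \<le> p \<bullet> b / h" "p \<bullet> b / h \<le> Y b" by linarith+
    then show "g p b \<in> {\<lfloor>- Y b\<rfloor>..\<lfloor>Y b\<rfloor>}"
      using b floor_mono[of "- Y b"] floor_mono[of _ "Y b"] by (simp add: g_def)
  next
    fix p b assume "b \<notin> B \<union> D" then show "g p b = undefined" by (simp add: g_def)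
  qed
  have finPi: "finite (PiE (B \<union> D) (\<lambda>b. {\<lfloor>- Y b\<rfloor>..\<lfloor>Y b\<rfloor>}))"
    using fin by (intro finite_PiE) auto
  have "card P = card (g ` P)" by (simp add: card_image inj)
  also have "\<dots> \<le> card (PiE (B \<union> D) (\<lambda>b. {\<lfloor>- Y b\<rfloor>..\<lfloor>Y b\<rfloor>}))" by (rule card_mono[OF finPi img])
  also have "\<dots> = (\<Prod>b\<in>B \<union> D. card {\<lfloor>- Y b\<rfloor>..\<lfloor>Y b\<rfloor>})" using fin by (simp add: card_PiE)
  finally have "real (card P) \<le> (\<Prod>b\<in>B \<union> D. real (card {\<lfloor>- Y b\<rfloor>..\<lfloor>Y b\<rfloor>}))"
    by (simp flip: of_nat_prod)
  \<comment> \<open>One unit pays for including both endpoints, the other for rounding the lower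
    endpoint down.\<close>
  also have "\<dots> \<le> (\<Prod>b\<in>B \<union> D. 2 * Y b + 2)"
  proof (intro prod_mono conjI)
    fix b
    have "0 \<le> Y b" using nonneg h by (simp add: Y_def)
    then show "real (card {\<lfloor>- Y b\<rfloor>..\<lfloor>Y b\<rfloor>}) \<le> 2 * Y b + 2"
      by (simp add: of_nat_nat) linarith
  qed simp
  also have "\<dots> = (\<Prod>b\<in>B. 2 * Y b + 2) * (\<Prod>b\<in>D. 2 * Y b + 2)"
    using fin disj by (simp add: prod.union_disjoint)
  also have "(\<Prod>b\<in>B. 2 * Y b + 2) = (\<Prod>b\<in>B. 2 * (a / h) + 2)"
    by (intro prod.cong refl) (simp add: Y_def)
  also have "(\<Prod>b\<in>D. 2 * Y b + 2) = (\<Prod>b\<in>D. 2 * (R / h) + 2)"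
    using disj by (intro prod.cong refl) (auto simp: Y_def)
  also have "2 * (a / h) + 2 = 4 * DIM('a) * a / t + 2" by (simp add: h_def N_def)
  also have "2 * (R / h) + 2 = 4 * DIM('a) * R / t + 2" by (simp add: h_def N_def)
  finally show ?thesis by (simp add: B(5) D(5) dW)
qed

text \<open>The mesh is arbitrary because this serves both the given set and the averaging grid of
  directions.\<close>

lemma separated_grid:
  fixes X :: "(real ^ 'n) set"
  assumes d: "0 < \<delta>" and X: "\<And>x i. x \<in> X \<Longrightarrow> \<exists>k::int. x $ i = \<delta> * of_int k"
  shows "separated \<delta> X"
  unfolding separated_def
proof (intro ballI impI)
  fix x y assume x: "x \<in> X" and y: "y \<in> X" and "x \<noteq> y"
  then obtain i where i: "x $ i \<noteq> y $ i" by (auto simp: vec_eq_iff)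
  obtain k l :: int where kl: "x $ i = \<delta> * of_int k" "y $ i = \<delta> * of_int l"
    using X[OF x] X[OF y] by metis
  have "k \<noteq> l" using i kl by auto
  then have "1 \<le> \<bar>real_of_int k - real_of_int l\<bar>" by linarith
  then have "\<delta> * 1 \<le> \<delta> * \<bar>real_of_int k - real_of_int l\<bar>" using d by (intro mult_left_mono) auto
  also have "\<dots> = \<bar>x $ i - y $ i\<bar>" using d by (simp add: kl abs_mult flip: right_diff_distrib)
  also have "\<dots> \<le> dist x y" using component_le_norm_cart[of "x - y" i] by (simp add: dist_norm)
  finally show "\<delta> \<le> dist x y" by simp
qed

subsection \<open>The Haar measure of the subspaces that almost annihilate a vector\<close>

lemma grassmannian_haar_finite_measure: "grassmannian_haar m \<nu> \<Longrightarrow> finite_measure \<nu>"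
  by (rule finite_measureI) (auto simp: grassmannian_haar_def simp del: space_vimage_algebra)

text \<open>The sigma-algebra is pulled back along the projection matrix, and for fixed u the norm
  of A u is continuous in the matrix A.\<close>

lemma grassmannian_haar_measurable:
  fixes u :: "real ^ 'n"
  assumes \<nu>: "grassmannian_haar m \<nu>"
  shows "{V \<in> grassmannian m. norm (closest_point V u) \<le> t} \<in> sets \<nu>"
proof -
  have sp: "space \<nu> = grassmannian m" and se: "sets \<nu> = sets (grassmannian_borel m)"
    using \<nu> by (auto simp: grassmannian_haar_def)
  have "(\<lambda>V. matrix (closest_point V)) \<in> measurable (grassmannian_borel m) (borel :: (real ^ 'n ^ 'n) measure)"
    unfolding grassmannian_borel_def by (rule measurable_vimage_algebra1) simp
  then have 1: "(\<lambda>V. matrix (closest_point V)) \<in> measurable \<nu> (borel :: (real ^ 'n ^ 'n) measure)"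
    using measurable_cong_sets[OF se refl] by blast
  have "continuous_on UNIV (\<lambda>A :: real ^ 'n ^ 'n. norm (A *v u))"
    unfolding matrix_vector_mult_def by (intro continuous_intros)
  then have 2: "(\<lambda>A :: real ^ 'n ^ 'n. norm (A *v u)) \<in> borel_measurable borel"
    by (rule borel_measurable_continuous_onI)
  have [measurable]: "(\<lambda>V. norm (matrix (closest_point V) *v u)) \<in> borel_measurable \<nu>"
    using measurable_compose[OF 1 2] .
  have "{V \<in> space \<nu>. norm (matrix (closest_point V) *v u) \<le> t} \<in> sets \<nu>" by measurable
  moreover have "matrix (closest_point V) *v u = closest_point V u" if "V \<in> grassmannian m" for V :: "(real ^ 'n) set"
    using that by (intro matrix_works)
      (simp add: grassmannian_def linear_matrix_vector_mul_eq linear_closest_point_subspace)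
  ultimately show ?thesis unfolding sp by (simp cong: conj_cong)
qed

text \<open>An orthogonal map that takes u to v carries the first set onto the second. Invariance
  speaks about images, so the image has to be identified exactly, and its surjectivity comes from
  the inverse map.\<close>

lemma grassmannian_haar_rotate:
  fixes u v :: "real ^ 'n"
  assumes \<nu>: "grassmannian_haar m \<nu>" and eq: "norm u = norm v"
  shows "measure \<nu> {V \<in> grassmannian m. norm (closest_point V u) \<le> t} =
    measure \<nu> {V \<in> grassmannian m. norm (closest_point V v) \<le> t}" (is "measure \<nu> ?U = measure \<nu> ?V")
proof -
  obtain T where T: "orthogonal_transformation T" "T u = v"
    using orthogonal_transformation_exists[OF eq] by blast
  have img: "T ` W \<in> grassmannian m" if "orthogonal_transformation T" "W \<in> grassmannian m" for T and W :: "(real ^ 'n) set"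
  proof -
    have lin: "linear T" and inj: "inj T" using that(1) orthogonal_transformation_linear orthogonal_transformation_inj by auto
    have "dim (T ` W) = dim W" using inj by (intro dim_image_eq[OF lin]) (auto intro: inj_on_subset)
    then show ?thesis using that(2) linear_subspace_image[OF lin] by (simp add: grassmannian_def)
  qed
  have "(\<lambda>W. T ` W) ` ?U = ?V"
  proof (intro antisym image_subsetI subsetI)
    fix W assume W: "W \<in> ?U"
    then have "closest_point (T ` W) v = T (closest_point W u)"
      using closest_point_orthogonal_transformation[OF _ T(1), of W u] T(2) by (simp add: grassmannian_def)
    then show "T ` W \<in> ?V" using W img[OF T(1)] orthogonal_transformation_norm[OF T(1)] by simp
  next
    fix W assume W: "W \<in> ?V"
    have T': "orthogonal_transformation (inv T)" using T(1) by (rule orthogonal_transformation_inv)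
    have i: "inv T v = u" using T orthogonal_transformation_inj by (metis inv_f_f)
    have "closest_point (inv T ` W) u = inv T (closest_point W v)"
      using closest_point_orthogonal_transformation[OF _ T', of W v] W by (simp add: grassmannian_def i)
    then have "inv T ` W \<in> ?U" using W img[OF T'] orthogonal_transformation_norm[OF T'] by simp
    moreover have "W = T ` (inv T ` W)"
      using orthogonal_transformation_surj[OF T(1)] by (simp add: image_f_inv_f)
    ultimately show "W \<in> (\<lambda>W. T ` W) ` ?U" by blast
  qed
  moreover have "emeasure \<nu> ((\<lambda>W. T ` W) ` ?U) = emeasure \<nu> ?U"
    using \<nu> T(1) grassmannian_haar_measurable[OF \<nu>] by (auto simp: grassmannian_haar_def)
  ultimately show ?thesis by (simp add: measure_def)
qed

text \<open>
  The measure is the same for all nonzero \<open>u\<close>, so it can be averaged over a grid of mesh \<open>t\<close> in the unit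
  ball. The grid has about \<open>t powr (- n)\<close> points, of which each \<open>V\<close> almost annihilates at most
  \<open>O(t powr (m - n))\<close>, because these lie in a thin neighbourhood of the orthogonal complement of \<open>V\<close>.
\<close>

lemma grassmannian_haar_le_of_scale:
  fixes u :: "real ^ 'n"
  assumes \<nu>: "grassmannian_haar m \<nu>" and m: "m < CARD('n)" and t: "0 < t" and u: "u \<noteq> 0"
  shows "measure \<nu> {V \<in> grassmannian m. norm (closest_point V u) \<le> t * norm u} \<le>
    2 * real CARD('n) ^ CARD('n) * (4 * real CARD('n) + 2) ^ CARD('n) * t ^ m"
proof -
  interpret finite_measure \<nu> by (rule grassmannian_haar_finite_measure[OF \<nu>])
  have sp: "space \<nu> = grassmannian m" and one: "measure \<nu> (space \<nu>) = 1"
    using \<nu> by (auto simp: grassmannian_haar_def measure_def)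
  define n where "n = CARD('n)"
  have n: "0 < n" "m < n" by (auto simp: n_def m)
  \<comment> \<open>The threshold is relative to the length of x. This makes \<open>H\<close>
    invariant under scaling, so all nonzero grid points can be compared with u although rotations
    preserve length.\<close>
  define H where "H x = {V \<in> grassmannian m. norm (closest_point V x) \<le> t * norm x}" for x :: "real ^ 'n"
  have H: "H x \<in> sets \<nu>" for x unfolding H_def by (rule grassmannian_haar_measurable[OF \<nu>])
  have const: "measure \<nu> (H x) = measure \<nu> (H u)" if "x \<noteq> 0" for x
  proof -
    define c where "c = norm u / norm x"
    have c: "0 < c" using that u by (simp add: c_def)
    have "closest_point V (c *\<^sub>R x) = c *\<^sub>R closest_point V x" if "V \<in> grassmannian m" for V :: "(real ^ 'n) set"
      using that by (intro linear_scale linear_closest_point_subspace) (simp add: grassmannian_def)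
    then have "H x = H (c *\<^sub>R x)" using c by (auto simp: H_def field_simps)
    moreover have "norm (c *\<^sub>R x) = norm u" using that by (simp add: c_def)
    ultimately show ?thesis
      using grassmannian_haar_rotate[OF \<nu>, of "c *\<^sub>R x" u "t * norm u"] by (simp add: H_def)
  qed
  show ?thesis
  proof (cases "t * real n \<le> 1")
    \<comment> \<open>For large t the claim exceeds the trivial bound 1, since the constant times
      t^m dominates (t n)^m.\<close>
    case False
    have "measure \<nu> (H u) \<le> 1" using bounded_measure[of "H u"] one by simp
    also have "1 \<le> (t * real n) ^ m" using False by (intro one_le_power) simp
    also have "\<dots> = t ^ m * (real n ^ m * (1 * 1))" by (simp add: power_mult_distrib)
    also have "\<dots> \<le> t ^ m * (real n ^ n * (2 * (4 * real n + 2) ^ n))"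
      using n t by (intro mult_left_mono mult_mono power_increasing one_le_power) auto
    finally show ?thesis by (simp add: H_def n_def mult_ac)
  next
    case True
    \<comment> \<open>Largest K for which the l1 bound n t K keeps the grid in the unit ball; still
      2 K + 1 \<ge> 1 / (n t), so the grid is large enough.\<close>
    define K where "K = \<lfloor>1 / (real n * t)\<rfloor>"
    have K1: "1 \<le> K" using True t n by (simp add: K_def field_simps)
    have Klow: "1 / (real n * t) \<le> 2 * real_of_int K + 1" using K1 unfolding K_def by linarith
    have Kup: "real_of_int K \<le> 1 / (real n * t)" unfolding K_def by simp
    define f where "f k = (\<chi> i. t * real_of_int (k i))" for k :: "'n \<Rightarrow> int"
    define U where "U = f ` (PiE UNIV (\<lambda>_. {-K..K}))"
    have finU: "finite U" unfolding U_def by (intro finite_imageI finite_PiE) auto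
    have "inj f" using t by (auto simp: inj_def f_def vec_eq_iff)
    then have "card U = card (PiE (UNIV :: 'n set) (\<lambda>_. {-K..K}))"
      unfolding U_def by (intro card_image) (auto intro: inj_on_subset)
    then have cU: "real (card U) = (2 * real_of_int K + 1) ^ n"
      using K1 by (simp add: card_PiE n_def of_nat_nat)
    have sepU: "separated t U" by (rule separated_grid[OF t]) (auto simp: U_def f_def)
    have normU: "norm x \<le> 1" if "x \<in> U" for x
    proof -
      obtain k where k: "x = f k" "\<And>i. k i \<in> {-K..K}" using \<open>x \<in> U\<close> unfolding U_def by (blast dest: PiE_mem)
      have k': "\<bar>real_of_int (k i)\<bar> \<le> of_int K" for i
      proof -
        have "- K \<le> k i" "k i \<le> K" using k(2)[of i] by auto
        then show ?thesis by linarith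
      qed
      have "norm x \<le> (\<Sum>i\<in>UNIV. \<bar>x $ i\<bar>)" by (rule norm_le_l1_cart)
      also have "\<dots> \<le> (\<Sum>i\<in>(UNIV :: 'n set). t * of_int K)"
        using k' t by (intro sum_mono) (simp add: k(1) f_def abs_mult)
      also have "\<dots> = real n * t * real_of_int K" by (simp add: n_def)
      also have "\<dots> \<le> real n * t * (1 / (real n * t))" using Kup t by (intro mult_left_mono) auto
      finally show ?thesis using t n by simp
    qed
    \<comment> \<open>Every V annihilates the origin, so it is removed. As the grid has at least two
      points, this costs a factor of at most 2.\<close>
    define U' where "U' = U - {0}"
    have "(3::real) ^ 1 \<le> 3 ^ n" using n by (intro power_increasing) auto
    also have "(3::real) ^ n \<le> (2 * real_of_int K + 1) ^ n" using K1 by (intro power_mono) auto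
    finally have "2 \<le> real (card U)" by (simp add: cU)
    moreover have "card U \<le> card U' + 1" using finU unfolding U'_def by (simp add: card_Diff_singleton_if) arith
    ultimately have cU': "real (card U) \<le> 2 * real (card U')" by simp
    \<comment> \<open>The box count for a slab of thickness t around the complement of V inside the
      unit ball, simplified by t \<le> 1.\<close>
    define b where "b = (4 * real n + 2) ^ m * ((4 * real n + 2) / t) ^ (n - m)"
    have t1: "t \<le> 1"
    proof -
      have "t * 1 \<le> t * real n" using t n by (intro mult_left_mono) auto
      with True show ?thesis by simp
    qed
    have count: "(\<Sum>x\<in>U'. indicator (H x) V) \<le> b" if V: "V \<in> space \<nu>" for V
    proof -
      have sV: "subspace V" "dim V = m" using V by (auto simp: sp grassmannian_def)
      define P where "P = {x \<in> U'. V \<in> H x}"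
      have P: "norm x \<le> 1" "norm (closest_point V x) \<le> t" if "x \<in> P" for x
      proof -
        show *: "norm x \<le> 1" using that normU by (simp add: P_def U'_def)
        have "norm (closest_point V x) \<le> t * norm x" using that by (simp add: P_def H_def)
        also have "\<dots> \<le> t * 1" using * t by (intro mult_left_mono) auto
        finally show "norm (closest_point V x) \<le> t" by simp
      qed
      have P': "norm (x - closest_point V x) \<le> 1" if "x \<in> P" for x
      proof -
        have "orthogonal (x - closest_point V x) (closest_point V x)"
          by (simp add: orthogonal_def closest_point_subspace_orthogonal closest_point_subspace_mem sV)
        from norm_add_Pythagorean[OF this] have "(norm (x - closest_point V x))\<^sup>2 \<le> (norm x)\<^sup>2" by simp
        then show ?thesis using P(1)[OF that] power2_le_imp_le norm_ge_zero by (metis order_trans)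
      qed
      have sepP: "separated t P" using sepU by (auto simp: separated_def P_def U'_def)
      have "(\<Sum>x\<in>U'. indicator (H x) V) = real (card P)"
        using finU by (simp add: P_def U'_def indicator_def sum.If_cases Int_def)
      also have "\<dots> \<le> (4 * n * t / t + 2) ^ m * (4 * n * 1 / t + 2) ^ (n - m)"
        using card_separated_le[OF sV(1) t sepP P(2) P'] t sV(2) by (simp add: n_def)
      also have "\<dots> \<le> (4 * real n + 2) ^ m * ((4 * real n + 2) / t) ^ (n - m)"
        using t t1 by (intro mult_mono power_mono) (auto simp: field_simps)
      finally show ?thesis by (simp add: b_def)
    qed
    have int: "integrable \<nu> (indicat_real (H x))" for x
      using H by (intro integrable_real_indicator) (auto simp: less_top[symmetric])
    have "real (card U') * measure \<nu> (H u) = (\<Sum>x\<in>U'. measure \<nu> (H x))" using const by (simp add: U'_def)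
    also have "\<dots> = (\<integral>V. (\<Sum>x\<in>U'. indicator (H x) V) \<partial>\<nu>)"
      using H int by (subst Bochner_Integration.integral_sum) (auto simp: sets.Int_space_eq2)
    also have "\<dots> \<le> (\<integral>V. b \<partial>\<nu>)"
      using int count by (intro integral_mono Bochner_Integration.integrable_sum) auto
    also have "\<dots> = b" by (simp add: one)
    finally have 1: "real (card U') * measure \<nu> (H u) \<le> b" .
    have "(1 / (real n * t)) ^ n * measure \<nu> (H u) \<le> real (card U) * measure \<nu> (H u)"
      unfolding cU using Klow n t by (intro mult_right_mono power_mono) auto
    also have "\<dots> \<le> 2 * real (card U') * measure \<nu> (H u)" using cU' by (intro mult_right_mono) auto
    also have "\<dots> \<le> 2 * b" using 1 by simp
    finally have "measure \<nu> (H u) \<le> 2 * b * (real n * t) ^ n"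
      using t n by (simp add: power_one_over field_simps)
    also have "\<dots> = 2 * real n ^ n * ((4 * real n + 2) ^ m * (4 * real n + 2) ^ (n - m)) * (t ^ n / t ^ (n - m))"
      by (simp add: b_def power_mult_distrib power_divide)
    also have "t ^ n / t ^ (n - m) = t ^ m" using t n by (simp add: power_diff)
    also have "(4 * real n + 2) ^ m * (4 * real n + 2) ^ (n - m) = (4 * real n + 2) ^ n"
      using n by (simp flip: power_add)
    finally show ?thesis by (simp add: H_def n_def)
  qed
qed

lemma grassmannian_haar_decay:
  fixes \<nu> :: "(real ^ 'n) set measure"
  assumes \<nu>: "grassmannian_haar m \<nu>" and m: "m < CARD('n)"
  obtains L where "1 \<le> L" and
    "\<And>u t. u \<noteq> 0 \<Longrightarrow> 0 < t \<Longrightarrow>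
      measure \<nu> {V \<in> grassmannian m. norm (closest_point V u) \<le> t} \<le> L * (t / norm u) ^ m"
proof
  show "1 \<le> 2 * real CARD('n) ^ CARD('n) * (4 * real CARD('n) + 2) ^ CARD('n)"
  proof -
    have "1 * 1 * 1 \<le> 2 * real CARD('n) ^ CARD('n) * (4 * real CARD('n) + 2) ^ CARD('n)"
      by (intro mult_mono one_le_power) (auto simp: Suc_leI)
    then show ?thesis by simp
  qed
  show "measure \<nu> {V \<in> grassmannian m. norm (closest_point V u) \<le> t} \<le>
    2 * real CARD('n) ^ CARD('n) * (4 * real CARD('n) + 2) ^ CARD('n) * (t / norm u) ^ m"
    if "u \<noteq> 0" "0 < t" for u :: "real ^ 'n" and t
    using grassmannian_haar_le_of_scale[OF \<nu> m, of "t / norm u" u] that by simp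
qed

subsection \<open>Katz--Tao sets\<close>

lemma sep_card_eq_card:
  assumes "finite A" "separated \<delta> A"
  shows "sep_card \<delta> A = card A"
  unfolding sep_card_def
proof (rule cSup_eq_maximum)
  show "card A \<in> {card S |S. S \<subseteq> A \<and> finite S \<and> separated \<delta> S}" using assms by auto
qed (auto intro: card_mono assms)

lemma separated_subset: "separated \<delta> S \<Longrightarrow> T \<subseteq> S \<Longrightarrow> separated \<delta> T"
  by (auto simp: separated_def)

text \<open>A point that is not strictly within \<delta> of P can be added to it. The strict
  inequality is also what membership in an open fibre neighborhood requires.\<close>

lemma finite_maximal_separated:
  fixes Y :: "'a::metric_space set"
  assumes "finite Y" "0 < \<delta>"
  shows "\<exists>P\<subseteq>Y. separated \<delta> P \<and> (\<forall>y\<in>Y. \<exists>p\<in>P. dist y p < \<delta>)"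
  using \<open>finite Y\<close>
proof induction
  case empty
  then show ?case by (auto simp: separated_def)
next
  case (insert y Y)
  then obtain P where P: "P \<subseteq> Y" "separated \<delta> P" "\<forall>y\<in>Y. \<exists>p\<in>P. dist y p < \<delta>" by auto
  show ?case
  proof (cases "\<exists>p\<in>P. dist y p < \<delta>")
    case True
    then show ?thesis using P by (intro exI[of _ P]) auto
  next
    case False
    then have "separated \<delta> (insert y P)" using P(2) by (force simp: separated_def dist_commute)
    then show ?thesis using P \<open>0 < \<delta>\<close> by (intro exI[of _ "insert y P"]) auto
  qed
qed

text \<open>Greedy choice: take a set of largest size, discard everything that meets it, and
  recurse. Sizes are abstract numbers because truncated fibres are not balls. Nonemptiness makes the
  chosen set meet itself, so the remaining family shrinks.\<close>

lemma finite_vitali: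
  fixes r :: "'i \<Rightarrow> real" and S :: "'i \<Rightarrow> 'a set"
  assumes "finite I" "\<And>i. i \<in> I \<Longrightarrow> S i \<noteq> {}"
  shows "\<exists>J\<subseteq>I. disjoint_family_on S J \<and> (\<forall>i\<in>I. \<exists>j\<in>J. S i \<inter> S j \<noteq> {} \<and> r i \<le> r j)"
  using assms
proof (induction rule: finite_psubset_induct)
  case (psubset I)
  show ?case
  proof (cases "I = {}")
    case False
    obtain k where k: "k \<in> I" "\<And>i. i \<in> I \<Longrightarrow> r i \<le> r k"
      using Max_in[of "r ` I"] Max_ge[of "r ` I"] False psubset.hyps by fastforce
    define I' where "I' = {i \<in> I. S i \<inter> S k = {}}"
    have "k \<notin> I'" using k psubset.prems by (auto simp: I'_def)
    then have "I' \<subset> I" using k by (auto simp: I'_def)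
    moreover have "S i \<noteq> {}" if "i \<in> I'" for i using that psubset.prems by (simp add: I'_def)
    ultimately obtain J where J: "J \<subseteq> I'" "disjoint_family_on S J"
      "\<forall>i\<in>I'. \<exists>j\<in>J. S i \<inter> S j \<noteq> {} \<and> r i \<le> r j"
      using psubset.IH[of I'] by blast
    have "disjoint_family_on S (insert k J)"
      using J(1,2) by (auto simp: disjoint_family_on_def I'_def)
    moreover have "\<exists>j\<in>insert k J. S i \<inter> S j \<noteq> {} \<and> r i \<le> r j" if "i \<in> I" for i
      using that J(3) k by (cases "i \<in> I'") (auto simp: I'_def)
    moreover have "insert k J \<subseteq> I" using J(1) k by (auto simp: I'_def)
    ultimately show ?thesis by blast
  qed (auto simp: disjoint_family_on_def)
qed

lemma katz_tao_empty: "0 \<le> C \<Longrightarrow> katz_tao \<delta> \<alpha> C {}"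
  by (simp add: katz_tao_def separated_def sep_card_eq_card)

lemma katz_tao_iff_card:
  assumes "finite Y" "separated \<delta> Y"
  shows "katz_tao \<delta> \<alpha> C Y \<longleftrightarrow> (\<forall>x. \<forall>r\<in>{\<delta>..1}. real (card (Y \<inter> cball x r)) \<le> C * (r / \<delta>) powr \<alpha>)"
proof -
  have "sep_card \<delta> (Y \<inter> cball x r) = card (Y \<inter> cball x r)" for x r
    using assms by (intro sep_card_eq_card separated_subset[OF assms(2)]) auto
  then show ?thesis by (simp add: katz_tao_def)
qed

text \<open>
  Among the subsets of \<open>Y\<close> that satisfy the bound with constant \<open>C\<close> in every fibre take one of
  maximal size. A point outside it lies in a ball where the bound is attained up to a factor of 2,
  and disjoint such balls, suitably enlarged, cover all these points.
\<close>

lemma katz_tao_fibres_refine: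
  fixes f :: "'a::metric_space \<Rightarrow> 'b::metric_space" and \<beta> A C \<delta> :: real
  assumes fin: "finite Y" and sep: "separated \<delta> Y" and \<delta>: "0 < \<delta>" and C: "1 \<le> C" and \<beta>: "0 \<le> \<beta>" and A: "0 \<le> A"
    and bound: "\<And>x r. x \<in> Y \<Longrightarrow> \<delta> \<le> r \<Longrightarrow>
      real (card {y \<in> Y. dist (f x) (f y) \<le> 4 * \<delta> \<and> dist x y \<le> r}) \<le> A * C * (r / \<delta>) powr \<beta>"
  shows "\<exists>Z\<subseteq>Y. (\<forall>p. katz_tao \<delta> \<beta> C (Z \<inter> {z. dist (f z) p < \<delta>})) \<and>
    real (card Y) \<le> (1 + 2 * 4 powr \<beta> * A) * real (card Z)"
proof -
  define S where "S p x r = {z. dist (f z) p < \<delta>} \<inter> cball x r" for p x r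
  define good where "good Z \<longleftrightarrow> (\<forall>p. katz_tao \<delta> \<beta> C (Z \<inter> {z. dist (f z) p < \<delta>}))" for Z
  have good_iff: "good Z \<longleftrightarrow> (\<forall>p x. \<forall>r\<in>{\<delta>..1}. real (card (Z \<inter> S p x r)) \<le> C * (r / \<delta>) powr \<beta>)"
    if "Z \<subseteq> Y" for Z
  proof -
    have "finite (Z \<inter> {z. dist (f z) p < \<delta>})" "separated \<delta> (Z \<inter> {z. dist (f z) p < \<delta>})" for p
      using that fin finite_subset[OF that fin] by (auto intro: separated_subset[OF sep])
    then show ?thesis by (simp add: good_def katz_tao_iff_card S_def Int_assoc)
  qed
  have "finite {Z. Z \<subseteq> Y \<and> good Z}" using fin by simp
  moreover have "{} \<in> {Z. Z \<subseteq> Y \<and> good Z}" using C by (simp add: good_def katz_tao_empty)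
  ultimately obtain Z where Z: "Z \<subseteq> Y" "good Z" and max: "\<And>Z'. Z' \<subseteq> Y \<Longrightarrow> good Z' \<Longrightarrow> card Z' \<le> card Z"
    using Max_in[of "card ` {Z. Z \<subseteq> Y \<and> good Z}"] Max_ge[of "card ` {Z. Z \<subseteq> Y \<and> good Z}"] by fastforce
  have finZ: "finite Z" using Z fin finite_subset by blast
  define t where "t r = C * (r / \<delta>) powr \<beta>" for r
  have "\<exists>p x r. r \<in> {\<delta>..1} \<and> y \<in> S p x r \<and> t r \<le> 2 * real (card (Z \<inter> S p x r))" if y: "y \<in> Y - Z" for y
  proof -
    have "\<not> good (insert y Z)" using max[of "insert y Z"] y Z(1) finZ by auto
    then obtain p x r where r: "r \<in> {\<delta>..1}" and big: "t r < real (card (insert y Z \<inter> S p x r))"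
      using good_iff[of "insert y Z"] y Z(1) by (auto simp: t_def not_le)
    have small: "real (card (Z \<inter> S p x r)) \<le> t r" using Z r good_iff[of Z] by (auto simp: t_def)
    have yS: "y \<in> S p x r" using big small by (cases "y \<in> S p x r") auto
    have "card (insert y Z \<inter> S p x r) = Suc (card (Z \<inter> S p x r))" using yS y finZ by simp
    then have *: "t r < real (card (Z \<inter> S p x r)) + 1" using big by simp
    \<comment> \<open>The bound is at least 1, so Z already has a point in the violated region. Then
      the count plus one is at most twice the count.\<close>
    have "1 * 1 \<le> t r"
      unfolding t_def using C \<beta> r \<delta> by (intro mult_mono ge_one_powr_ge_zero) auto
    then have "1 \<le> card (Z \<inter> S p x r)" using * by linarith
    then have "t r \<le> 2 * real (card (Z \<inter> S p x r))" using * by linarith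
    then show ?thesis using r yS by blast
  qed
  then obtain p x r where pxr: "\<And>y. y \<in> Y - Z \<Longrightarrow> r y \<in> {\<delta>..1} \<and> y \<in> S (p y) (x y) (r y) \<and>
      t (r y) \<le> 2 * real (card (Z \<inter> S (p y) (x y) (r y)))"
    by metis
  define B where "B y = S (p y) (x y) (r y)" for y
  have "finite (Y - Z)" using fin by simp
  moreover have "B y \<noteq> {}" if "y \<in> Y - Z" for y using pxr[OF that] by (auto simp: B_def)
  ultimately obtain J where J: "J \<subseteq> Y - Z" "disjoint_family_on B J"
    "\<And>y. y \<in> Y - Z \<Longrightarrow> \<exists>j\<in>J. B y \<inter> B j \<noteq> {} \<and> r y \<le> r j"
    using finite_vitali[of "Y - Z" B r] by blast
  have finJ: "finite J" using J(1) fin finite_subset by blast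
  \<comment> \<open>The path from j to y runs through a common point of the two regions. Each half
    costs twice a radius, and the radius at y is at most that at j.\<close>
  define D where "D j = {y \<in> Y. dist (f j) (f y) \<le> 4 * \<delta> \<and> dist j y \<le> 4 * r j}" for j
  have "Y - Z \<subseteq> (\<Union>j\<in>J. D j)"
  proof
    fix y assume y: "y \<in> Y - Z"
    then obtain j w where j: "j \<in> J" "r y \<le> r j" and w: "w \<in> B y" "w \<in> B j" using J(3) by blast
    have yB: "y \<in> B y" and jB: "j \<in> B j" using pxr y j(1) J(1) by (auto simp: B_def)
    have "dist (f j) (f w) \<le> dist (f j) (p j) + dist (f w) (p j)" by (rule dist_triangle2)
    moreover have "dist (f w) (f y) \<le> dist (f w) (p y) + dist (f y) (p y)" by (rule dist_triangle2)
    moreover have "dist (f j) (f y) \<le> dist (f j) (f w) + dist (f w) (f y)" by (rule dist_triangle)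
    moreover have "dist j w \<le> dist (x j) j + dist (x j) w" by (rule dist_triangle3)
    moreover have "dist w y \<le> dist (x y) w + dist (x y) y" by (rule dist_triangle3)
    moreover have "dist j y \<le> dist j w + dist w y" by (rule dist_triangle)
    ultimately have "dist (f j) (f y) \<le> 4 * \<delta>" "dist j y \<le> 4 * r j"
      using yB jB w j(2) unfolding B_def S_def by auto
    then show "y \<in> (\<Union>j\<in>J. D j)" using y j(1) by (auto simp: D_def)
  qed
  then have "card (Y - Z) \<le> card (\<Union>j\<in>J. D j)"
    using finJ fin by (intro card_mono) (auto simp: D_def)
  also have "\<dots> \<le> (\<Sum>j\<in>J. card (D j))" by (rule card_UN_le[OF finJ])
  finally have "real (card (Y - Z)) \<le> (\<Sum>j\<in>J. real (card (D j)))" by (simp flip: of_nat_sum)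
  also have "\<dots> \<le> (\<Sum>j\<in>J. 2 * 4 powr \<beta> * A * real (card (Z \<inter> B j)))"
  proof (rule sum_mono)
    fix j assume j: "j \<in> J"
    then have r: "\<delta> \<le> r j" and tj: "t (r j) \<le> 2 * real (card (Z \<inter> B j))"
      using pxr J(1) by (auto simp: B_def)
    \<comment> \<open>The enlarged radius may exceed 1, which is why \<open>bound\<close> is assumed
      for all radii from \<delta> on.\<close>
    have "real (card (D j)) \<le> A * C * (4 * r j / \<delta>) powr \<beta>"
      unfolding D_def using j J(1) r \<delta> by (intro bound) auto
    also have "\<dots> = 4 powr \<beta> * A * t (r j)"
    proof -
      have "(4 * (r j / \<delta>)) powr \<beta> = 4 powr \<beta> * (r j / \<delta>) powr \<beta>" by (rule powr_mult)
      then show ?thesis by (simp add: t_def)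
    qed
    also have "\<dots> \<le> 4 powr \<beta> * A * (2 * real (card (Z \<inter> B j)))"
      using tj A by (intro mult_left_mono) auto
    finally show "real (card (D j)) \<le> 2 * 4 powr \<beta> * A * real (card (Z \<inter> B j))" by simp
  qed
  also have "\<dots> = 2 * 4 powr \<beta> * A * real (\<Sum>j\<in>J. card (Z \<inter> B j))" by (simp add: sum_distrib_left)
  also have "(\<Sum>j\<in>J. card (Z \<inter> B j)) = card (\<Union>j\<in>J. Z \<inter> B j)"
    using finJ finZ J(2) by (intro card_UN_disjoint[symmetric]) (auto simp: disjoint_family_on_def)
  also have "2 * 4 powr \<beta> * A * real (card (\<Union>j\<in>J. Z \<inter> B j)) \<le> 2 * 4 powr \<beta> * A * real (card Z)"
    using finZ A by (intro mult_left_mono) (auto intro!: card_mono)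
  finally have "real (card (Y - Z)) \<le> 2 * 4 powr \<beta> * A * real (card Z)" .
  moreover have "card Y = card Z + card (Y - Z)"
    using card_Diff_subset[OF finZ Z(1)] card_mono[OF fin Z(1)] by simp
  ultimately have "real (card Y) \<le> (1 + 2 * 4 powr \<beta> * A) * real (card Z)" by (simp add: algebra_simps)
  then show ?thesis using Z good_def by blast
qed

text \<open>On each dyadic shell the decay of the kernel cancels the growth in the Katz-Tao bound,
  leaving C 2^\<alpha> per scale. That bound stops at radius 1, so distant points are counted
  through the cover by unit balls.\<close>

lemma katz_tao_kernel_sum:
  fixes X :: "'a::metric_space set" and \<delta> \<alpha> C :: real
  assumes fin: "finite X" and sep: "separated \<delta> X" and \<delta>: "0 < \<delta>" "\<delta> < 1" and \<alpha>: "0 \<le> \<alpha>"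
    and kt: "katz_tao \<delta> \<alpha> C X" and F: "finite F" "X \<subseteq> (\<Union>c\<in>F. cball c 1)"
  shows "(\<Sum>y\<in>X. (\<delta> / max (dist x y) \<delta>) powr \<alpha>) \<le>
    C * 2 powr \<alpha> * (1 + log 2 (1 / \<delta>) + real (card F))"
proof -
  have kt': "real (card (X \<inter> cball z r)) \<le> C * (r / \<delta>) powr \<alpha>" if "\<delta> \<le> r" "r \<le> 1" for z r
    using kt that unfolding katz_tao_iff_card[OF fin sep] by auto
  have C: "0 \<le> C" using order_trans[OF of_nat_0_le_iff kt'[of \<delta> undefined]] \<delta> by simp
  \<comment> \<open>The last dyadic scale with 2^K \<delta> \<le> 1; points beyond it are at
    distance more than 1/2, so their weight is at most (2 \<delta>)^\<alpha>.\<close>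
  define K where "K = nat \<lfloor>log 2 (1 / \<delta>)\<rfloor>"
  have l0: "0 \<le> log 2 (1 / \<delta>)" using \<delta> by simp
  have K: "real K \<le> log 2 (1 / \<delta>)" "log 2 (1 / \<delta>) < real (Suc K)" using l0 unfolding K_def by linarith+
  have "2 powr real K \<le> 1 / \<delta>" using K(1) \<delta> by (subst powr_le_iff) auto
  then have K1: "2 ^ K * \<delta> \<le> 1" using \<delta> by (simp add: powr_realpow field_simps)
  have "1 / \<delta> < 2 powr real (Suc K)" using K(2) \<delta> by (subst less_powr_iff) auto
  then have K2: "1 < 2 ^ K * (2 * \<delta>)" using \<delta> by (simp add: powr_realpow field_simps del: of_nat_Suc)
  have pointwise: "(\<delta> / max d \<delta>) powr \<alpha> \<le>
      (\<Sum>k\<le>K. (2 / 2 ^ k) powr \<alpha> * of_bool (d \<le> 2 ^ k * \<delta>)) + (2 * \<delta>) powr \<alpha>" for d :: real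
  proof (cases "d \<le> 2 ^ K * \<delta>")
    case True
    \<comment> \<open>Minimality gives d > 2^(k-1) \<delta> for k > 0, so the single term k of the
      sum already dominates.\<close>
    define k where "k = (LEAST k. d \<le> 2 ^ k * \<delta>)"
    have k: "d \<le> 2 ^ k * \<delta>" "k \<le> K" unfolding k_def using True by (auto intro: LeastI Least_le)
    have "\<delta> / max d \<delta> \<le> 2 / 2 ^ k"
    proof (cases k)
      case 0
      have "\<delta> / max d \<delta> \<le> 1" using \<delta> by (simp add: divide_le_eq)
      then show ?thesis using 0 by simp
    next
      case (Suc l)
      then have "\<not> d \<le> 2 ^ l * \<delta>" using not_less_Least[of l "\<lambda>k. d \<le> 2 ^ k * \<delta>"] by (simp add: k_def)
      then have *: "2 ^ l * \<delta> \<le> max d \<delta>" by simp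
      have "\<delta> / max d \<delta> \<le> \<delta> / (2 ^ l * \<delta>)" using * \<delta> by (intro divide_left_mono) auto
      then show ?thesis using Suc \<delta> by simp
    qed
    then have "(\<delta> / max d \<delta>) powr \<alpha> \<le> (2 / 2 ^ k) powr \<alpha>" using \<delta> \<alpha> by (intro powr_mono2) auto
    also have "\<dots> = (\<Sum>k\<in>{k}. (2 / 2 ^ k) powr \<alpha> * of_bool (d \<le> 2 ^ k * \<delta>))" using k by simp
    also have "\<dots> \<le> (\<Sum>k\<le>K. (2 / 2 ^ k) powr \<alpha> * of_bool (d \<le> 2 ^ k * \<delta>))"
      using k by (intro sum_mono2) auto
    finally show ?thesis by (simp add: add_increasing2)
  next
    case False
    have "\<delta> / max d \<delta> \<le> \<delta> / (2 ^ K * \<delta>)" using False \<delta> by (intro divide_left_mono) auto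
    also have "\<dots> \<le> 2 * \<delta>" using K2 \<delta> by (simp add: field_simps)
    finally have "(\<delta> / max d \<delta>) powr \<alpha> \<le> (2 * \<delta>) powr \<alpha>" using \<delta> \<alpha> by (intro powr_mono2) auto
    then show ?thesis by (intro add_increasing sum_nonneg) auto
  qed
  have "X = (\<Union>c\<in>F. X \<inter> cball c 1)" using F(2) by auto
  then have "card X \<le> (\<Sum>c\<in>F. card (X \<inter> cball c 1))" using card_UN_le[OF F(1), of "\<lambda>c. X \<inter> cball c 1"] by simp
  then have "real (card X) \<le> (\<Sum>c\<in>F. real (card (X \<inter> cball c 1)))" by (simp flip: of_nat_sum)
  also have "\<dots> \<le> (\<Sum>c\<in>F. C * (1 / \<delta>) powr \<alpha>)" using \<delta> by (intro sum_mono kt') auto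
  finally have cX: "real (card X) \<le> real (card F) * (C * (1 / \<delta>) powr \<alpha>)" by simp
  have "(\<Sum>y\<in>X. (\<delta> / max (dist x y) \<delta>) powr \<alpha>) \<le>
      (\<Sum>y\<in>X. (\<Sum>k\<le>K. (2 / 2 ^ k) powr \<alpha> * of_bool (dist x y \<le> 2 ^ k * \<delta>)) + (2 * \<delta>) powr \<alpha>)"
    by (intro sum_mono pointwise)
  also have "\<dots> = (\<Sum>k\<le>K. (2 / 2 ^ k) powr \<alpha> * (\<Sum>y\<in>X. of_bool (dist x y \<le> 2 ^ k * \<delta>))) + real (card X) * (2 * \<delta>) powr \<alpha>"
    unfolding sum.distrib by (subst sum.swap) (simp only: sum_distrib_left sum_constant)
  also have "\<dots> \<le> (\<Sum>k\<le>K. C * 2 powr \<alpha>) + C * 2 powr \<alpha> * real (card F)"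
  proof (intro add_mono sum_mono)
    fix k assume "k \<in> {..K}"
    then have "(2::real) ^ k * \<delta> \<le> 2 ^ K * \<delta>" using \<delta> by (intro mult_right_mono power_increasing) auto
    then have k: "2 ^ k * \<delta> \<le> 1" using K1 by simp
    have "(\<Sum>y\<in>X. of_bool (dist x y \<le> 2 ^ k * \<delta>)) = real (card (X \<inter> cball x (2 ^ k * \<delta>)))"
      using fin by (simp add: Int_def)
    also have "\<dots> \<le> C * (2 ^ k * \<delta> / \<delta>) powr \<alpha>" using k \<delta> by (intro kt') auto
    finally have "(2 / 2 ^ k) powr \<alpha> * (\<Sum>y\<in>X. of_bool (dist x y \<le> 2 ^ k * \<delta>)) \<le> (2 / 2 ^ k) powr \<alpha> * (C * (2 ^ k) powr \<alpha>)"
      using \<delta> by (intro mult_left_mono) auto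
    also have "\<dots> = C * 2 powr \<alpha>" by (simp add: powr_divide)
    finally show "(2 / 2 ^ k) powr \<alpha> * (\<Sum>y\<in>X. of_bool (dist x y \<le> 2 ^ k * \<delta>)) \<le> C * 2 powr \<alpha>" .
  next
    have "real (card X) * (2 * \<delta>) powr \<alpha> \<le> real (card F) * (C * (1 / \<delta>) powr \<alpha>) * (2 * \<delta>) powr \<alpha>"
      using cX by (intro mult_right_mono) auto
    also have "\<dots> = C * 2 powr \<alpha> * real (card F)" using \<delta> by (simp add: powr_divide powr_mult)
    finally show "real (card X) * (2 * \<delta>) powr \<alpha> \<le> C * 2 powr \<alpha> * real (card F)" .
  qed
  also have "\<dots> = C * 2 powr \<alpha> * (1 + real K + real (card F))" by (simp add: algebra_simps)
  also have "\<dots> \<le> C * 2 powr \<alpha> * (1 + log 2 (1 / \<delta>) + real (card F))"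
    using K C by (intro mult_left_mono) auto
  finally show ?thesis .
qed

section \<open>Subsets of the grid cube\<close>

lemma grid_cube_norm_le:
  fixes x :: "real ^ 'n"
  assumes "x \<in> grid_cube \<delta>"
  shows "norm x \<le> CARD('n)"
proof -
  have "norm x \<le> (\<Sum>i\<in>UNIV. \<bar>x $ i\<bar>)" by (rule norm_le_l1_cart)
  also have "\<dots> \<le> (\<Sum>i\<in>(UNIV :: 'n set). 1)"
    using assms by (intro sum_mono) (auto simp: grid_cube_def abs_le_iff minus_le_iff)
  finally show ?thesis by simp
qed

lemma separated_grid_cube:
  assumes "0 < \<delta>" "X \<subseteq> grid_cube \<delta>"
  shows "separated \<delta> X"
  using assms(2) by (intro separated_grid[OF assms(1)]) (auto simp: grid_cube_def)

lemma finite_grid_cube: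
  fixes X :: "(real ^ 'n) set"
  assumes "0 < \<delta>" "X \<subseteq> grid_cube \<delta>"
  shows "finite X"
proof -
  have "bounded X" using assms(2) grid_cube_norm_le by (auto simp: bounded_iff)
  moreover have "uniform_discrete X"
    using separated_grid_cube[OF assms] assms(1) by (force simp: separated_def uniform_discrete_def not_less)
  ultimately show ?thesis using uniform_discrete_finite_iff by blast
qed

subsection \<open>The exceptional set of subspaces\<close>

text \<open>
  The kernel \<open>\<kappa>\<close> will be \<open>(\<delta> / max (dist x y) \<delta>) powr \<beta>\<close> with \<open>\<beta> = max (\<alpha> - m) 0\<close>. Its sum over a slice
  controls the cardinality of the slice in all balls around \<open>x\<close> at once, so that no union
  over scales is needed when Markov's inequality is applied.
\<close>

lemma exceptional_subspaces:
  fixes \<nu> :: "(real ^ 'n) set measure" and X :: "(real ^ 'n) set" and \<kappa> :: "real ^ 'n \<Rightarrow> real ^ 'n \<Rightarrow> real"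
    and T s \<epsilon> :: real
  assumes \<nu>: "grassmannian_haar m \<nu>" and fin: "finite X" and T: "0 < T" and \<epsilon>: "0 < \<epsilon>"
    and nonneg: "\<And>x y. 0 \<le> \<kappa> x y"
    and bound: "\<And>x. x \<in> X \<Longrightarrow>
      (\<Sum>y\<in>X. \<kappa> x y * measure \<nu> {V \<in> grassmannian m. norm (closest_point V (y - x)) \<le> s}) \<le> T"
  shows "\<exists>E\<in>sets \<nu>. measure \<nu> E \<le> \<epsilon> \<and>
    (\<forall>V\<in>grassmannian m - E. (\<Sum>x\<in>X. \<Sum>y\<in>{y \<in> X. norm (closest_point V (y - x)) \<le> s}. \<kappa> x y) \<le> card X * T / \<epsilon>)"
proof (cases "X = {}")
  case True
  then show ?thesis using \<epsilon> by (intro bexI[of _ "{}"]) auto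
next
  case False
  interpret finite_measure \<nu> by (rule grassmannian_haar_finite_measure[OF \<nu>])
  have sp: "space \<nu> = grassmannian m" using \<nu> by (auto simp: grassmannian_haar_def)
  define A where "A u = {V \<in> grassmannian m. norm (closest_point V u) \<le> s}" for u :: "real ^ 'n"
  have A: "A u \<in> sets \<nu>" for u unfolding A_def by (rule grassmannian_haar_measurable[OF \<nu>])
  have int: "integrable \<nu> (indicat_real (A u))" for u
    using A by (intro integrable_real_indicator) (auto simp: less_top[symmetric])
  define F where "F V = (\<Sum>x\<in>X. \<Sum>y\<in>X. \<kappa> x y * indicat_real (A (y - x)) V)" for V
  have intF: "integrable \<nu> F"
    unfolding F_def using int by (intro Bochner_Integration.integrable_sum integrable_mult_right) auto
  have "integral\<^sup>L \<nu> F = (\<Sum>x\<in>X. \<Sum>y\<in>X. \<kappa> x y * measure \<nu> (A (y - x)))"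
    unfolding F_def using int A
    by (simp add: Bochner_Integration.integral_sum Bochner_Integration.integrable_sum sets.Int_space_eq2)
  also have "\<dots> \<le> (\<Sum>x\<in>X. T)" using bound by (intro sum_mono) (simp add: A_def)
  finally have I: "integral\<^sup>L \<nu> F \<le> card X * T" by simp
  \<comment> \<open>The Markov threshold that makes the exceptional measure \<epsilon>; it is
    positive because X is nonempty here.\<close>
  define c where "c = card X * T / \<epsilon>"
  have c: "0 < c" using False fin T \<epsilon> by (simp add: c_def card_gt_0_iff)
  define E where "E = {V \<in> space \<nu>. c \<le> F V}"
  have "E \<in> sets \<nu>" using intF unfolding E_def by measurable
  moreover have "measure \<nu> E \<le> \<epsilon>"
  proof -
    have "measure \<nu> E \<le> integral\<^sup>L \<nu> F / c"
    proof -
      have "0 \<le> F V" for V unfolding F_def using nonneg by (intro sum_nonneg) auto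
      then show ?thesis
        unfolding E_def using intF c by (intro integral_Markov_inequality_measure[where A = "space \<nu>"]) auto
    qed
    also have "\<dots> \<le> (card X * T) / c" using I c by (intro divide_right_mono) auto
    also have "\<dots> = \<epsilon>" using False fin T \<epsilon> by (simp add: c_def)
    finally show ?thesis .
  qed
  moreover have "(\<Sum>x\<in>X. \<Sum>y\<in>{y \<in> X. norm (closest_point V (y - x)) \<le> s}. \<kappa> x y) \<le> c" if V: "V \<in> grassmannian m - E" for V
  proof -
    have "(\<Sum>y\<in>{y \<in> X. norm (closest_point V (y - x)) \<le> s}. \<kappa> x y) = (\<Sum>y\<in>X. \<kappa> x y * indicat_real (A (y - x)) V)" for x
      using fin V by (simp add: A_def indicator_def sum.inter_filter of_bool_def mult.commute if_distrib cong: if_cong)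
    then have "(\<Sum>x\<in>X. \<Sum>y\<in>{y \<in> X. norm (closest_point V (y - x)) \<le> s}. \<kappa> x y) = F V" by (simp add: F_def)
    also have "\<dots> \<le> c" using V by (auto simp: E_def sp not_le)
    finally show ?thesis .
  qed
  ultimately show ?thesis unfolding c_def by blast
qed

section \<open>From averages to counts in balls\<close>

lemma card_filter_twice_mean:
  fixes \<Phi> :: "'a \<Rightarrow> real" and H :: real
  assumes fin: "finite X" and nonneg: "\<And>x. x \<in> X \<Longrightarrow> 0 \<le> \<Phi> x" and H: "0 < H"
    and sum: "(\<Sum>x\<in>X. \<Phi> x) \<le> card X * H"
  shows "real (card X) \<le> 2 * real (card {x \<in> X. \<Phi> x \<le> 2 * H})"
proof -
  let ?B = "{x \<in> X. \<not> \<Phi> x \<le> 2 * H}"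
  have "real (card ?B) * (2 * H) = (\<Sum>x\<in>?B. 2 * H)" by simp
  also have "\<dots> \<le> (\<Sum>x\<in>?B. \<Phi> x)" by (intro sum_mono) auto
  also have "\<dots> \<le> (\<Sum>x\<in>X. \<Phi> x)" using fin nonneg by (intro sum_mono2) auto
  also note sum
  finally have "2 * real (card ?B) * H \<le> card X * H" by simp
  then have "2 * real (card ?B) \<le> card X" using H by simp
  moreover have "card X = card {x \<in> X. \<Phi> x \<le> 2 * H} + card ?B"
    using fin by (subst card_Un_disjoint[symmetric]) (auto intro!: arg_cong[where f = card])
  ultimately show ?thesis by simp
qed

text \<open>The kernel decreases with distance, so every point within r contributes at least
  (\<delta> / r)^\<beta>.\<close>

lemma card_le_kernel_sum:
  fixes X :: "'a::metric_space set"
  assumes fin: "finite X" and r: "0 < \<delta>" "\<delta> \<le> r" and \<beta>: "0 \<le> \<beta>"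
  shows "real (card {y \<in> X. dist x y \<le> r}) \<le> (\<Sum>y\<in>X. (\<delta> / max (dist x y) \<delta>) powr \<beta>) * (r / \<delta>) powr \<beta>"
proof -
  have "real (card {y \<in> X. dist x y \<le> r}) * (\<delta> / r) powr \<beta> = (\<Sum>y\<in>{y \<in> X. dist x y \<le> r}. (\<delta> / r) powr \<beta>)" by simp
  also have "\<dots> \<le> (\<Sum>y\<in>{y \<in> X. dist x y \<le> r}. (\<delta> / max (dist x y) \<delta>) powr \<beta>)"
    using r \<beta> by (intro sum_mono powr_mono2 divide_left_mono) auto
  also have "\<dots> \<le> (\<Sum>y\<in>X. (\<delta> / max (dist x y) \<delta>) powr \<beta>)" using fin by (intro sum_mono2) auto
  finally have "real (card {y \<in> X. dist x y \<le> r}) * (\<delta> / r) powr \<beta> * (r / \<delta>) powr \<beta> \<le>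
      (\<Sum>y\<in>X. (\<delta> / max (dist x y) \<delta>) powr \<beta>) * (r / \<delta>) powr \<beta>" by (rule mult_right_mono) simp
  moreover have "(\<delta> / r) powr \<beta> * (r / \<delta>) powr \<beta> = 1" using r by (simp flip: powr_mult)
  ultimately show ?thesis by (simp add: mult.assoc)
qed

text \<open>The inequality ln z \<le> z - 1 at z = \<delta>^(-\<epsilon>). The constant blows up as
  \<epsilon> tends to 0 but is independent of \<delta>, as \<delta>-losses allow.\<close>

lemma log2_inverse_le:
  assumes "0 < \<delta>" "\<delta> < 1" "0 < \<epsilon>"
  shows "log 2 (1 / \<delta>) \<le> \<delta> powr (- \<epsilon>) / (\<epsilon> * ln 2)"
proof -
  have "\<epsilon> * ln (1 / \<delta>) = ln (\<delta> powr (- \<epsilon>))" using assms by (simp add: ln_powr ln_div)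
  also have "\<dots> \<le> \<delta> powr (- \<epsilon>)" using assms ln_le_minus_one[of "\<delta> powr (- \<epsilon>)"] by simp
  finally have "ln (1 / \<delta>) \<le> \<delta> powr (- \<epsilon>) / \<epsilon>" using assms by (simp add: pos_le_divide_eq mult.commute)
  then have "ln (1 / \<delta>) / ln 2 \<le> \<delta> powr (- \<epsilon>) / \<epsilon> / ln 2" by (intro divide_right_mono) auto
  then show ?thesis by (simp add: log_def)
qed

text \<open>The base points form a maximal separated set of projections of X. They lie in V, so the
  complement contributes only a power of 2 to the box count.\<close>

lemma fibre_cover_exists:
  fixes X V :: "(real ^ 'n) set"
  assumes \<delta>: "0 < \<delta>" "\<delta> < 1" and X: "X \<subseteq> grid_cube \<delta>" and V: "V \<in> grassmannian m"
  shows "\<exists>P. finite P \<and> P \<subseteq> V \<and> separated \<delta> P \<and>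
    real (card P) \<le> (4 * real CARD('n) * real CARD('n) + 2) ^ m * 2 ^ (CARD('n) - m) * \<delta> powr (- real m) \<and>
    X \<subseteq> (\<Union>p\<in>P. fibre_nbhd \<delta> V p)"
proof -
  have sV: "subspace V" "dim V = m" using V by (auto simp: grassmannian_def)
  have fin: "finite (closest_point V ` X)" using finite_grid_cube[OF \<delta>(1) X] by simp
  obtain P where P: "P \<subseteq> closest_point V ` X" "separated \<delta> P" "\<forall>y\<in>closest_point V ` X. \<exists>p\<in>P. dist y p < \<delta>"
    using finite_maximal_separated[OF fin \<delta>(1)] by blast
  have finP: "finite P" using P(1) fin finite_subset by blast
  have PV: "P \<subseteq> V" using P(1) closest_point_subspace_mem[OF sV(1)] by blast
  define n where "n = real CARD('n)"
  have normP: "norm (closest_point V p) \<le> n" "norm (p - closest_point V p) \<le> 0" if "p \<in> P" for p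
  proof -
    have id: "closest_point V p = p" using PV that by (intro closest_point_self) auto
    obtain x where x: "x \<in> X" "p = closest_point V x" using P(1) \<open>p \<in> P\<close> by auto
    have "norm p \<le> norm x" using norm_closest_point_subspace_le[OF sV(1)] x by simp
    also have "\<dots> \<le> n" using grid_cube_norm_le X x by (auto simp: n_def)
    finally show "norm (closest_point V p) \<le> n" by (simp add: id)
    show "norm (p - closest_point V p) \<le> 0" by (simp add: id)
  qed
  have "real (card P) \<le> (4 * n * n / \<delta> + 2) ^ m * 2 ^ (CARD('n) - m)"
    using card_separated_le[OF sV(1) \<delta>(1) P(2) normP] sV(2) by (simp add: n_def)
  also have "\<dots> \<le> ((4 * n * n + 2) / \<delta>) ^ m * 2 ^ (CARD('n) - m)"
    using \<delta> by (intro mult_right_mono power_mono) (auto simp: field_simps n_def)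
  also have "\<dots> = (4 * n * n + 2) ^ m * 2 ^ (CARD('n) - m) * \<delta> powr (- real m)"
    using \<delta> by (simp add: power_divide powr_minus powr_realpow divide_inverse power_mult_distrib power_inverse)
  finally have "real (card P) \<le> (4 * n * n + 2) ^ m * 2 ^ (CARD('n) - m) * \<delta> powr (- real m)" .
  moreover have "X \<subseteq> (\<Union>p\<in>P. fibre_nbhd \<delta> V p)"
  proof
    fix x assume "x \<in> X"
    then obtain p where p: "p \<in> P" "dist (closest_point V x) p < \<delta>" using P(3) by blast
    then have "x \<in> fibre_nbhd \<delta> V p" using PV mem_fibre_nbhd_iff[OF sV(1), of p x \<delta>] by (auto simp: dist_norm)
    then show "x \<in> (\<Union>p\<in>P. fibre_nbhd \<delta> V p)" using p(1) by blast
  qed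
  ultimately show ?thesis using finP PV P(2) unfolding n_def by blast
qed

text \<open>Half of the points have a slice sum at most twice the average, and for these all ball
  counts in the thickened slice are controlled. C and H are kept apart: C survives as the constant
  of the slices, while H is paid for in cardinality.\<close>

lemma fibre_refinement_exists:
  fixes X V :: "(real ^ 'n) set" and \<beta> C H \<delta> :: real
  assumes \<delta>: "0 < \<delta>" and X: "X \<subseteq> grid_cube \<delta>" and V: "subspace V" and \<beta>: "0 \<le> \<beta>"
    and C: "1 \<le> C" and H: "0 < H"
    and sum: "(\<Sum>x\<in>X. \<Sum>y\<in>{y \<in> X. norm (closest_point V (y - x)) \<le> 4 * \<delta>}. (\<delta> / max (dist x y) \<delta>) powr \<beta>)
      \<le> card X * (C * H)"
  shows "\<exists>Z\<subseteq>X. (\<forall>p\<in>V. katz_tao \<delta> \<beta> C (Z \<inter> fibre_nbhd \<delta> V p)) \<and>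
    real (card X) \<le> 2 * (1 + 4 * 4 powr \<beta> * H) * real (card Z)"
proof -
  have fin: "finite X" and sep: "separated \<delta> X"
    using finite_grid_cube[OF \<delta> X] separated_grid_cube[OF \<delta> X] by auto
  define N where "N x = {y \<in> X. norm (closest_point V (y - x)) \<le> 4 * \<delta>}" for x
  define \<Phi> where "\<Phi> x = (\<Sum>y\<in>N x. (\<delta> / max (dist x y) \<delta>) powr \<beta>)" for x
  define Y where "Y = {x \<in> X. \<Phi> x \<le> 2 * (C * H)}"
  have Y: "Y \<subseteq> X" "finite Y" "separated \<delta> Y" using fin separated_subset[OF sep] by (auto simp: Y_def)
  have half: "real (card X) \<le> 2 * real (card Y)"
    unfolding Y_def using fin sum C H
    by (intro card_filter_twice_mean) (auto simp: \<Phi>_def N_def intro!: sum_nonneg)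
  have bnd: "real (card {y \<in> Y. dist (closest_point V x) (closest_point V y) \<le> 4 * \<delta> \<and> dist x y \<le> r})
      \<le> (2 * H) * C * (r / \<delta>) powr \<beta>" if x: "x \<in> Y" and r: "\<delta> \<le> r" for x r
  proof -
    have finN: "finite (N x)" using fin by (simp add: N_def)
    have "dist (closest_point V x) (closest_point V y) = norm (closest_point V (y - x))" for y
      by (simp add: linear_diff[OF linear_closest_point_subspace[OF V]] dist_norm norm_minus_commute)
    then have "{y \<in> Y. dist (closest_point V x) (closest_point V y) \<le> 4 * \<delta> \<and> dist x y \<le> r} \<subseteq> {y \<in> N x. dist x y \<le> r}"
      using Y(1) by (auto simp: N_def)
    then have "real (card {y \<in> Y. dist (closest_point V x) (closest_point V y) \<le> 4 * \<delta> \<and> dist x y \<le> r})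
        \<le> real (card {y \<in> N x. dist x y \<le> r})" using finN by (intro of_nat_mono card_mono) auto
    also have "\<dots> \<le> \<Phi> x * (r / \<delta>) powr \<beta>"
      unfolding \<Phi>_def by (rule card_le_kernel_sum[OF finN \<delta> r \<beta>])
    also have "\<dots> \<le> 2 * (C * H) * (r / \<delta>) powr \<beta>" using x by (intro mult_right_mono) (auto simp: Y_def)
    finally show ?thesis by (simp add: mult_ac)
  qed
  obtain Z where Z: "Z \<subseteq> Y" "\<And>p. katz_tao \<delta> \<beta> C (Z \<inter> {z. dist (closest_point V z) p < \<delta>})"
    and card: "real (card Y) \<le> (1 + 2 * 4 powr \<beta> * (2 * H)) * real (card Z)"
    using katz_tao_fibres_refine[OF Y(2,3) \<delta> C \<beta> _ bnd] H by auto
  have "fibre_nbhd \<delta> V p = {z. dist (closest_point V z) p < \<delta>}" if "p \<in> V" for p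
    using mem_fibre_nbhd_iff[OF V that] by (auto simp: dist_norm)
  moreover have "real (card X) \<le> 2 * (1 + 4 * 4 powr \<beta> * H) * real (card Z)"
  proof -
    have "2 * real (card Y) \<le> 2 * ((1 + 2 * 4 powr \<beta> * (2 * H)) * real (card Z))" using card by simp
    also have "\<dots> = 2 * (1 + 4 * 4 powr \<beta> * H) * real (card Z)" by (simp add: algebra_simps)
    finally show ?thesis using half by linarith
  qed
  ultimately show ?thesis using Z Y(1) by (intro exI[of _ Z]) auto
qed

theorem theorem4p2:
  fixes m :: nat and \<alpha> \<epsilon>\<^sub>0 :: real and \<nu> :: "(real ^ 'n) set measure"
  assumes "1 < \<alpha>" and "\<alpha> \<le> real CARD('n)"
    and "1 \<le> m" and "m < CARD('n)"
    and "0 < \<epsilon>\<^sub>0"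
    and "grassmannian_haar m \<nu>"
  shows "\<exists>M::real. \<forall>K::real \<Rightarrow> real. \<exists>K'::real \<Rightarrow> real.
    \<forall>\<delta> C. \<forall>X :: (real ^ 'n) set.
      0 < \<delta> \<longrightarrow> \<delta> < 1 \<longrightarrow> X \<subseteq> grid_cube \<delta> \<longrightarrow>
      lessapprox K \<delta> C 1 \<longrightarrow> katz_tao \<delta> \<alpha> C X \<longrightarrow>
      (\<exists>E \<in> sets \<nu>. measure \<nu> E \<le> \<epsilon>\<^sub>0 \<and>
        (\<forall>V \<in> grassmannian m - E.
          \<exists>P. finite P \<and> P \<subseteq> V \<and> separated \<delta> P \<and>
            real (card P) \<le> M * \<delta> powr (- real m) \<and>
            (\<exists>X' \<subseteq> X.
              X' \<subseteq> (\<Union>p\<in>P. fibre_nbhd \<delta> V p) \<and>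
              lessapprox K' \<delta> (real (card X)) (real (card X')) \<and>
              (\<forall>p\<in>P. katz_tao \<delta> (max (\<alpha> - real m) 0) C (X' \<inter> fibre_nbhd \<delta> V p)))))"
proof -
  obtain L where L: "1 \<le> L" and decay: "\<And>(u :: real ^ 'n) t. u \<noteq> 0 \<Longrightarrow> 0 < t \<Longrightarrow>
      measure \<nu> {V \<in> grassmannian m. norm (closest_point V u) \<le> t} \<le> L * (t / norm u) ^ m"
    using grassmannian_haar_decay[OF assms(6,4)] by blast
  interpret finite_measure \<nu> by (rule grassmannian_haar_finite_measure[OF assms(6)])
  have one: "measure \<nu> A \<le> 1" for A
  proof -
    have "measure \<nu> (space \<nu>) = 1" using assms(6) by (auto simp: grassmannian_haar_def measure_def)
    then show ?thesis using bounded_measure[of A] by simp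
  qed
  obtain F :: "(real ^ 'n) set" where F: "finite F" "cball 0 (real CARD('n)) \<subseteq> (\<Union>c\<in>F. ball c 1)"
    using compact_cball[of "0 :: real ^ 'n" "real CARD('n)"] unfolding compact_eq_totally_bounded
    by (meson zero_less_one)
  define \<beta> where "\<beta> = max (\<alpha> - real m) 0"
  have \<beta>: "0 \<le> \<beta>" "\<alpha> \<le> \<beta> + real m" by (auto simp: \<beta>_def)
  \<comment> \<open>The factor 4^m comes from the tolerance 4 \<delta>, 2^\<alpha> from rounding
    distances to dyadic scales, and 1 / \<open>\<epsilon>\<^sub>0\<close> from Markov's inequality
    in V.\<close>
  define D where "D = L * 4 ^ m * 2 powr \<alpha> / \<epsilon>\<^sub>0"
  have D: "0 < D" using L assms(5) by (simp add: D_def)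
  define H where "H \<delta> = D * (1 + log 2 (1 / \<delta>) + real (card F))" for \<delta>
  define M where "M = (4 * real CARD('n) * real CARD('n) + 2) ^ m * 2 ^ (CARD('n) - m)"
  \<comment> \<open>The loss of the refinement, with the logarithm in \<open>H\<close> replaced by
    its coefficient against \<delta>^(-\<epsilon>).\<close>
  define K' where "K' \<epsilon> = 2 * (1 + 4 * 4 powr \<beta> * (D * (1 + 1 / (\<epsilon> * ln 2) + real (card F))))" for \<epsilon> :: real
  have main: "\<exists>E \<in> sets \<nu>. measure \<nu> E \<le> \<epsilon>\<^sub>0 \<and>
        (\<forall>V \<in> grassmannian m - E.
          \<exists>P. finite P \<and> P \<subseteq> V \<and> separated \<delta> P \<and>
            real (card P) \<le> M * \<delta> powr (- real m) \<and>
            (\<exists>X' \<subseteq> X.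
              X' \<subseteq> (\<Union>p\<in>P. fibre_nbhd \<delta> V p) \<and>
              lessapprox K' \<delta> (real (card X)) (real (card X')) \<and>
              (\<forall>p\<in>P. katz_tao \<delta> \<beta> C (X' \<inter> fibre_nbhd \<delta> V p))))"
    if \<delta>: "0 < \<delta>" "\<delta> < 1" and X: "X \<subseteq> grid_cube \<delta>" and kt: "katz_tao \<delta> \<alpha> C X"
    for \<delta> C and X :: "(real ^ 'n) set"
  proof (cases "X = {}")
    \<comment> \<open>Without a point of X there is no lower bound on C; the empty family of fibres
      serves.\<close>
    case True
    have "0 \<le> M" by (simp add: M_def)
    then show ?thesis using True \<delta> assms(5)
      by (intro bexI[of _ "{}"] conjI ballI exI[of _ "{}"]) (auto simp: separated_def lessapprox_def)
  next
    case False
    have fin: "finite X" and sep: "separated \<delta> X"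
      using finite_grid_cube[OF \<delta>(1) X] separated_grid_cube[OF \<delta>(1) X] by auto
    have l0: "0 \<le> log 2 (1 / \<delta>)" using \<delta> by simp
    have H: "0 < H \<delta>" using D l0 by (simp add: H_def add_pos_nonneg)
    have C: "1 \<le> C"
    proof -
      obtain x where x: "x \<in> X" using False by blast
      have d: "\<delta> \<in> {\<delta>..1}" using \<delta> by simp
      have "X \<inter> cball x \<delta> \<noteq> {}" using x \<delta> by auto
      then have "1 \<le> real (card (X \<inter> cball x \<delta>))" using fin by (simp add: Suc_leI card_gt_0_iff)
      also have "real (card (X \<inter> cball x \<delta>)) \<le> C * (\<delta> / \<delta>) powr \<alpha>" using kt d unfolding katz_tao_iff_card[OF fin sep] by blast
      finally show ?thesis using \<delta> by simp
    qed
    have XF: "X \<subseteq> (\<Union>c\<in>F. cball c 1)"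
    proof
      fix x assume "x \<in> X"
      then have "x \<in> cball 0 (real CARD('n))" using X grid_cube_norm_le by auto
      then obtain c where "c \<in> F" "x \<in> ball c 1" using F(2) by blast
      then show "x \<in> (\<Union>c\<in>F. cball c 1)" using ball_subset_cball by blast
    qed
    have "(\<Sum>y\<in>X. (\<delta> / max (dist x y) \<delta>) powr \<beta> *
        measure \<nu> {V \<in> grassmannian m. norm (closest_point V (y - x)) \<le> 4 * \<delta>}) \<le> \<epsilon>\<^sub>0 * (C * H \<delta>)"
      if x: "x \<in> X" for x
    proof -
      have "(\<delta> / max (dist x y) \<delta>) powr \<beta> * measure \<nu> {V \<in> grassmannian m. norm (closest_point V (y - x)) \<le> 4 * \<delta>}
          \<le> L * 4 ^ m * (\<delta> / max (dist x y) \<delta>) powr \<alpha>" if y: "y \<in> X" for y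
      proof -
        define q where "q = \<delta> / max (dist x y) \<delta>"
        have q: "0 < q" "q \<le> 1" using \<delta> by (auto simp: q_def divide_le_eq less_max_iff_disj)
        have "measure \<nu> {V \<in> grassmannian m. norm (closest_point V (y - x)) \<le> 4 * \<delta>} \<le> L * 4 ^ m * q ^ m"
        proof (cases "y = x")
          \<comment> \<open>The decay estimate excludes the zero vector; on the diagonal q = 1, and
            any probability is at most 1.\<close>
          case True
          have "1 * 1 \<le> L * 4 ^ m" using L by (intro mult_mono one_le_power) auto
          then show ?thesis
            using order_trans[OF one[of "{V \<in> grassmannian m. norm (closest_point V (y - x)) \<le> 4 * \<delta>}"]] True \<delta>
            by (simp add: q_def)
        next
          case False
          then have "\<delta> \<le> dist x y" using sep x y by (auto simp: separated_def)
          then have "q = \<delta> / norm (y - x)" by (simp add: q_def dist_norm norm_minus_commute max_def)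
          then show ?thesis using decay[of "y - x" "4 * \<delta>"] False \<delta> by (simp add: power_mult_distrib power_divide)
        qed
        then have "q powr \<beta> * measure \<nu> {V \<in> grassmannian m. norm (closest_point V (y - x)) \<le> 4 * \<delta>}
            \<le> q powr \<beta> * (L * 4 ^ m * q ^ m)" by (intro mult_left_mono) auto
        also have "\<dots> = L * 4 ^ m * q powr (\<beta> + real m)" using q by (simp add: powr_add powr_realpow)
        also have "\<dots> \<le> L * 4 ^ m * q powr \<alpha>" using q \<beta> L by (intro mult_left_mono powr_mono') auto
        finally show ?thesis by (simp add: q_def)
      qed
      then have "(\<Sum>y\<in>X. (\<delta> / max (dist x y) \<delta>) powr \<beta> *
          measure \<nu> {V \<in> grassmannian m. norm (closest_point V (y - x)) \<le> 4 * \<delta>})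
          \<le> (\<Sum>y\<in>X. L * 4 ^ m * (\<delta> / max (dist x y) \<delta>) powr \<alpha>)" by (rule sum_mono)
      also have "\<dots> = L * 4 ^ m * (\<Sum>y\<in>X. (\<delta> / max (dist x y) \<delta>) powr \<alpha>)" by (simp add: sum_distrib_left)
      also have "\<dots> \<le> L * 4 ^ m * (C * 2 powr \<alpha> * (1 + log 2 (1 / \<delta>) + real (card F)))"
        using L assms(1) by (intro mult_left_mono katz_tao_kernel_sum[OF fin sep \<delta> _ kt F(1) XF]) auto
      also have "\<dots> = \<epsilon>\<^sub>0 * (C * H \<delta>)" using assms(5) by (simp add: H_def D_def)
      finally show ?thesis .
    qed
    then obtain E where E: "E \<in> sets \<nu>" "measure \<nu> E \<le> \<epsilon>\<^sub>0" and
      sum: "\<And>V. V \<in> grassmannian m - E \<Longrightarrow>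
        (\<Sum>x\<in>X. \<Sum>y\<in>{y \<in> X. norm (closest_point V (y - x)) \<le> 4 * \<delta>}. (\<delta> / max (dist x y) \<delta>) powr \<beta>)
          \<le> card X * (\<epsilon>\<^sub>0 * (C * H \<delta>)) / \<epsilon>\<^sub>0"
      using exceptional_subspaces[OF assms(6) fin, of "\<epsilon>\<^sub>0 * (C * H \<delta>)" \<epsilon>\<^sub>0
        "\<lambda>x y. (\<delta> / max (dist x y) \<delta>) powr \<beta>" "4 * \<delta>"] assms(5) C H by auto
    have "\<exists>P. finite P \<and> P \<subseteq> V \<and> separated \<delta> P \<and>
        real (card P) \<le> M * \<delta> powr (- real m) \<and>
        (\<exists>X' \<subseteq> X.
          X' \<subseteq> (\<Union>p\<in>P. fibre_nbhd \<delta> V p) \<and>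
          lessapprox K' \<delta> (real (card X)) (real (card X')) \<and>
          (\<forall>p\<in>P. katz_tao \<delta> \<beta> C (X' \<inter> fibre_nbhd \<delta> V p)))" if V: "V \<in> grassmannian m - E" for V
    proof -
      have sV: "subspace V" using V by (simp add: grassmannian_def)
      obtain P where P: "finite P" "P \<subseteq> V" "separated \<delta> P" "real (card P) \<le> M * \<delta> powr (- real m)"
        "X \<subseteq> (\<Union>p\<in>P. fibre_nbhd \<delta> V p)"
        using fibre_cover_exists[OF \<delta> X, of V m] V unfolding M_def by blast
      have "(\<Sum>x\<in>X. \<Sum>y\<in>{y \<in> X. norm (closest_point V (y - x)) \<le> 4 * \<delta>}. (\<delta> / max (dist x y) \<delta>) powr \<beta>)
          \<le> card X * (C * H \<delta>)" using sum[OF V] assms(5) by simp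
      from fibre_refinement_exists[OF \<delta>(1) X sV \<beta>(1) C H this]
      obtain Z where Z: "Z \<subseteq> X" "\<And>p. p \<in> V \<Longrightarrow> katz_tao \<delta> \<beta> C (Z \<inter> fibre_nbhd \<delta> V p)"
        and card: "real (card X) \<le> 2 * (1 + 4 * 4 powr \<beta> * H \<delta>) * real (card Z)" by blast
      have "lessapprox K' \<delta> (real (card X)) (real (card Z))"
        unfolding lessapprox_def
      proof (intro allI impI)
        fix \<epsilon> :: real assume \<epsilon>: "0 < \<epsilon>"
        \<comment> \<open>This lets the terms without a logarithm be absorbed into
          \<delta>^(-\<epsilon>) as well.\<close>
        have d1: "1 \<le> \<delta> powr (- \<epsilon>)" using \<delta> \<epsilon> by (simp add: powr_minus powr_le1 one_le_inverse)
        let ?d = "\<delta> powr (- \<epsilon>)"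
        have "H \<delta> \<le> D * (1 * ?d + ?d / (\<epsilon> * ln 2) + real (card F) * ?d)"
          unfolding H_def using D d1 log2_inverse_le[OF \<delta> \<epsilon>]
          by (intro mult_left_mono add_mono) (auto simp: mult_le_cancel_left1)
        also have "\<dots> = D * (1 + 1 / (\<epsilon> * ln 2) + real (card F)) * ?d" by (simp add: distrib_right distrib_left)
        finally have h: "H \<delta> \<le> D * (1 + 1 / (\<epsilon> * ln 2) + real (card F)) * ?d" .
        have "2 * (1 + 4 * 4 powr \<beta> * H \<delta>) \<le> 2 * (?d + 4 * 4 powr \<beta> * (D * (1 + 1 / (\<epsilon> * ln 2) + real (card F)) * ?d))"
          using d1 h by (intro mult_left_mono add_mono) auto
        also have "\<dots> = K' \<epsilon> * ?d" by (simp add: K'_def distrib_right distrib_left)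
        finally have "2 * (1 + 4 * 4 powr \<beta> * H \<delta>) * real (card Z) \<le> K' \<epsilon> * ?d * real (card Z)"
          by (intro mult_right_mono) auto
        then show "real (card X) \<le> K' \<epsilon> * ?d * real (card Z)" by (rule order_trans[OF card])
      qed
      moreover have "Z \<subseteq> (\<Union>p\<in>P. fibre_nbhd \<delta> V p)" using Z(1) P(5) by (rule order_trans)
      moreover have "\<forall>p\<in>P. katz_tao \<delta> \<beta> C (Z \<inter> fibre_nbhd \<delta> V p)" using Z(2) P(2) by auto
      ultimately show ?thesis using P(1-4) Z(1) by (intro exI[of _ P] conjI exI[of _ Z])
    qed
    then show ?thesis using E by blast
  qed
  show ?thesis
    by (rule exI[of _ M], rule allI, rule exI[of _ K'], (rule allI impI)+, rule main[unfolded \<beta>_def]; assumption)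
qed

end
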